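(* Let $(\Gamma,\mathbf k)$ be a negative color scheme, $p$ a prime and $s\ge1$. The group $H^0(\Gamma,\mathbf k;\mathbf Z/p^s)$ is generated by its subgroups $p^dD^d_s(\Gamma,\mathbf k)\subset H^0(\Gamma,\mathbf k;\mathbf Z/p^s)$, $0\le d<s$.
   Context: Graphs are finite, without loops or multiple edges; $e(v,w)$ denotes the edge joining $v,w$. A negative color scheme $(\Gamma,\mathbf k)$ is a graph $\Gamma$ with a positive integer $k_v$ for each vertex $v$; subgraphs carry the restricted weights. $C^*(\Gamma,\mathbf k)$ has $C^0=\mathbf Z[V(\Gamma)]$, $C^1=\mathbf Z[E(\Gamma)]$, $d^0(v)=\sum_{w} k_w\, e(v,w)$ (sum over neighbours $w$ of $v$). $H^*(\Gamma,\mathbf k;R)$ is the cohomology of $C^*(\Gamma,\mathbf k)\otimes R$; $H^0(\Gamma,\mathbf k;R)\subset C^0(\Gamma,\mathbf k;R)$ is the group of cocycles. Let $i:\mathbf Z/p^{t-1}\to\mathbf Z/p^t$ be $i(x)=px$. $\mathcal{CR}(\Delta,\mathbf k;\mathbf Z/p^t)$ is the cokernel of $i_*:H^0(\Delta,\mathbf k;\mathbf Z/p^{t-1})\to H^0(\Delta,\mathbf k;\mathbf Z/p^t)$. A connected $(\Delta,\mathbf k)$ is $\mathbf Z/p^t$-oriented if this cokernel is $\cong\mathbf Z/p$; a $\mathbf Z/p^t$-orientation class is then an element of $H^0(\Delta,\mathbf k;\mathbf Z/p^t)$ mapping to a generator of the cokernel. $\mathrm{Red}_{p^r}(\Gamma,\mathbf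 k)$ is obtained from $\Gamma$ by removing all edges $e(v,w)$ with $\mathrm{val}_p(k_vk_w)\ge r$, keeping all vertices; $\mathrm{Red}_{p^\infty}(\Gamma,\mathbf k)=\Gamma$. For a subgraph $\Delta\subset\Gamma$, its edge boundary $B(\Delta)$ is the set of edges of $\Gamma$ not in $E(\Delta)$ having at least one endpoint in $V(\Delta)$. Put $m(\Delta)=\min_{v\in V(\Delta)}\mathrm{val}_p(k_v)$ and $r(\Delta)=\inf_{e(v,w)\in B(\Delta)}\mathrm{val}_p(k_vk_w)$, with $r(\Delta)=\infty$ if $B(\Delta)=\emptyset$. $D^d_s(\Gamma,\mathbf k)$ is the subgroup of $C^0(\Gamma,\mathbf k;\mathbf Z/p^s)$ generated by the classes $\mathcal{D}iv\{\Delta\}$, where $\Delta$ ranges over the connected subgraphs of $\Gamma$ with $r(\Delta)-m(\Delta)\ge s-d$ which are $\mathbf Z/p^{s-d}$-oriented components of $\mathrm{Red}_{p^{r(\Delta)}}(\Gamma,\mathbf k)$ with orientation class $\mathcal{D}iv\{\Delta\}$. Here $\mathcal{D}iv\{\Delta\}=\sum_{v\in V(\Delta)}\alpha(v)\frac{k_v}{g}\,v$, with $g$ the greatest common divisor of $\{k_v\}_{v\in V(\Delta)}$ and $\alpha:V(\Delta)\to\{\pm1\}$ a sign function for which this cochain is a $\mathbf Z/p^{s-d}$-orientation class of $(\Delta,\mathbf k)$ (one such $\alpha$ is chosen for each $\Delta$ admitting one; for bipartite $\Delta$ it is the bipartitioning, i.e. $\alpha$ takes different values at the endpoints of every edge).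 The cochain is regarded as an element of $C^0(\Gamma,\mathbf k;\mathbf Z/p^s)$ via $V(\Delta)\subset V(\Gamma)$. With these conditions $p^dD^d_s(\Gamma,\mathbf k)$ consists of cocycles, hence lies in $H^0(\Gamma,\mathbf k;\mathbf Z/p^s)$. *)

theory Defs
  imports "HOL-Algebra.Product_Groups" "HOL-Computational_Algebra.Primes" "HOL-Library.Extended_Nat"
begin

section \<open>Finite simple graphs\<close>

text \<open>The edge joining \<open>v\<close> and \<open>w\<close> is the two-element set \<open>{v, w}\<close>.\<close>

datatype 'a graph = Graph (verts: "'a set") (edges: "'a set set")

definition simple_graph :: "'a graph \<Rightarrow> bool" where
  "simple_graph \<Gamma> \<longleftrightarrow> finite (verts \<Gamma>) \<and>
     (\<forall>e\<in>edges \<Gamma>. \<exists>v\<in>verts \<Gamma>. \<exists>w\<in>verts \<Gamma>. v \<noteq> w \<and> e = {v, w})"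

definition nbs :: "'a graph \<Rightarrow> 'a \<Rightarrow> 'a set" where
  "nbs \<Gamma> v = {w. {v, w} \<in> edges \<Gamma>}"

definition subgraph :: "'a graph \<Rightarrow> 'a graph \<Rightarrow> bool" where
  "subgraph \<Delta> \<Gamma> \<longleftrightarrow>
     simple_graph \<Delta> \<and> verts \<Delta> \<subseteq> verts \<Gamma> \<and> edges \<Delta> \<subseteq> edges \<Gamma>"

text \<open>Connected graphs are nonempty.\<close>

definition graph_connected :: "'a graph \<Rightarrow> bool" where
  "graph_connected \<Delta> \<longleftrightarrow> verts \<Delta> \<noteq> {} \<and>
     (\<forall>v\<in>verts \<Delta>. \<forall>w\<in>verts \<Delta>. (v, w) \<in> {(x, y). {x, y} \<in> edges \<Delta>}\<^sup>*)"

definition component :: "'a graph \<Rightarrow> 'a graph \<Rightarrow> bool" where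
  "component \<Delta> \<Gamma> \<longleftrightarrow> subgraph \<Delta> \<Gamma> \<and> graph_connected \<Delta> \<and>
     (\<forall>\<Delta>'. subgraph \<Delta>' \<Gamma> \<and> graph_connected \<Delta>' \<and> subgraph \<Delta> \<Delta>' \<longrightarrow> \<Delta>' = \<Delta>)"

definition sign_function :: "'a graph \<Rightarrow> ('a \<Rightarrow> int) \<Rightarrow> bool" where
  "sign_function \<Delta> \<alpha> \<longleftrightarrow> (\<forall>v\<in>verts \<Delta>. \<alpha> v = 1 \<or> \<alpha> v = -1)"

definition bipartitioning :: "'a graph \<Rightarrow> ('a \<Rightarrow> int) \<Rightarrow> bool" where
  "bipartitioning \<Delta> \<alpha> \<longleftrightarrow> sign_function \<Delta> \<alpha> \<and>
     (\<forall>v w. {v, w} \<in> edges \<Delta> \<longrightarrow> \<alpha> v \<noteq> \<alpha> w)"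

definition bipartite :: "'a graph \<Rightarrow> bool" where
  "bipartite \<Delta> \<longleftrightarrow> (\<exists>\<alpha>. bipartitioning \<Delta> \<alpha>)"


section \<open>Negative color schemes and their cohomology\<close>

definition negative_color_scheme :: "'a graph \<Rightarrow> ('a \<Rightarrow> nat) \<Rightarrow> bool" where
  "negative_color_scheme \<Gamma> k \<longleftrightarrow> simple_graph \<Gamma> \<and> (\<forall>v\<in>verts \<Gamma>. 0 < k v)"

text \<open>
  For coefficients \<open>R = \<int>/n\<close> the groups \<open>\<int>[V] \<otimes> R\<close> and \<open>\<int>[E] \<otimes> R\<close> are written as products
  of copies of \<open>\<int>/n\<close>. Elements of \<open>\<int>/n\<close> are represented by integers in \<open>{0..<n}\<close>.
  These abelian groups are written multiplicatively: in particular
  \<open>x [^] m\<close> is the multiple \<open>m x\<close>. The trivial group \<open>\<int>/1\<close> is included.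
\<close>

definition C0 :: "'a graph \<Rightarrow> nat \<Rightarrow> ('a \<Rightarrow> int) monoid" where
  "C0 \<Gamma> n = product_group (verts \<Gamma>) (\<lambda>_. integer_mod_group n)"

definition C1 :: "'a graph \<Rightarrow> nat \<Rightarrow> ('a set \<Rightarrow> int) monoid" where
  "C1 \<Gamma> n = product_group (edges \<Gamma>) (\<lambda>_. integer_mod_group n)"

text \<open>
  The coordinate at \<open>e\<close> of the linear extension of \<open>v \<mapsto> \<Sum>\<^sub>w k\<^sub>w e(v,w)\<close>. The inner sum
  is the coefficient of \<open>e\<close> in the coboundary of the generator \<open>v\<close>.
\<close>

definition d0 :: "'a graph \<Rightarrow> ('a \<Rightarrow> nat) \<Rightarrow> nat \<Rightarrow> ('a \<Rightarrow> int) \<Rightarrow> 'a set \<Rightarrow> int" where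
  "d0 \<Gamma> k n x = (\<lambda>e\<in>edges \<Gamma>.
     (\<Sum>v\<in>verts \<Gamma>. x v * (\<Sum>w\<in>nbs \<Gamma> v. int (k w) * (if {v, w} = e then 1 else 0))) mod int n)"

definition H0 :: "'a graph \<Rightarrow> ('a \<Rightarrow> nat) \<Rightarrow> nat \<Rightarrow> ('a \<Rightarrow> int) monoid" where
  "H0 \<Gamma> k n = (C0 \<Gamma> n)\<lparr>carrier := kernel (C0 \<Gamma> n) (C1 \<Gamma> n) (d0 \<Gamma> k n)\<rparr>"

text \<open>The map on cochains induced by \<open>\<int>/p\<^sup>t\<^sup>-\<^sup>1 \<rightarrow> \<int>/p\<^sup>t\<close>, \<open>x \<mapsto> p x\<close>; used for \<open>t \<ge> 1\<close> only.\<close>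

definition i_star :: "'a graph \<Rightarrow> nat \<Rightarrow> nat \<Rightarrow> ('a \<Rightarrow> int) \<Rightarrow> 'a \<Rightarrow> int" where
  "i_star \<Delta> p t x = (\<lambda>v\<in>verts \<Delta>. (int p * x v) mod int (p ^ t))"

definition i_image :: "'a graph \<Rightarrow> ('a \<Rightarrow> nat) \<Rightarrow> nat \<Rightarrow> nat \<Rightarrow> ('a \<Rightarrow> int) set" where
  "i_image \<Delta> k p t = i_star \<Delta> p t ` carrier (H0 \<Delta> k (p ^ (t - 1)))"

definition CR :: "'a graph \<Rightarrow> ('a \<Rightarrow> nat) \<Rightarrow> nat \<Rightarrow> nat \<Rightarrow> ('a \<Rightarrow> int) set monoid" where
  "CR \<Delta> k p t = H0 \<Delta> k (p ^ t) Mod i_image \<Delta> k p t"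


section \<open>Orientations\<close>

definition oriented :: "'a graph \<Rightarrow> ('a \<Rightarrow> nat) \<Rightarrow> nat \<Rightarrow> nat \<Rightarrow> bool" where
  "oriented \<Delta> k p t \<longleftrightarrow> graph_connected \<Delta> \<and> CR \<Delta> k p t \<cong> integer_mod_group p"

definition orientation_class ::
    "'a graph \<Rightarrow> ('a \<Rightarrow> nat) \<Rightarrow> nat \<Rightarrow> nat \<Rightarrow> ('a \<Rightarrow> int) \<Rightarrow> bool" where
  "orientation_class \<Delta> k p t x \<longleftrightarrow> oriented \<Delta> k p t \<and> x \<in> carrier (H0 \<Delta> k (p ^ t)) \<and>
     generate (CR \<Delta> k p t) {i_image \<Delta> k p t #>\<^bsub>H0 \<Delta> k (p ^ t)\<^esub> x} = carrier (CR \<Delta> k p t)"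

text \<open>
  \<open>Div \<alpha> k \<Delta>\<close> is the integral cochain, extended by zero outside \<open>\<Delta>\<close>; the division is exact.
  Its reductions give the class in \<open>C\<^sup>0(\<Delta>; \<int>/p\<^sup>s\<^sup>-\<^sup>d)\<close> and the one in \<open>C\<^sup>0(\<Gamma>; \<int>/p\<^sup>s)\<close>.
\<close>

definition Div :: "('a \<Rightarrow> int) \<Rightarrow> ('a \<Rightarrow> nat) \<Rightarrow> 'a graph \<Rightarrow> 'a \<Rightarrow> int" where
  "Div \<alpha> k \<Delta> v = (if v \<in> verts \<Delta> then \<alpha> v * int (k v div Gcd (k ` verts \<Delta>)) else 0)"

definition cochain_mod :: "'a graph \<Rightarrow> nat \<Rightarrow> ('a \<Rightarrow> int) \<Rightarrow> 'a \<Rightarrow> int" where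
  "cochain_mod \<Gamma> n x = (\<lambda>v\<in>verts \<Gamma>. x v mod int n)"

definition orienting_sign ::
    "'a graph \<Rightarrow> ('a \<Rightarrow> nat) \<Rightarrow> nat \<Rightarrow> nat \<Rightarrow> ('a \<Rightarrow> int) \<Rightarrow> bool" where
  "orienting_sign \<Delta> k p t \<alpha> \<longleftrightarrow> sign_function \<Delta> \<alpha> \<and>
     orientation_class \<Delta> k p t (cochain_mod \<Delta> (p ^ t) (Div \<alpha> k \<Delta>))"

text \<open>
  A choice, for every exponent \<open>t\<close> and every connected subgraph \<open>\<Delta>\<close> that admits one, of a sign
  function whose cochain is a \<open>\<int>/p\<^sup>t\<close>-orientation class. The values of \<open>\<alpha>\<close> elsewhere are
  irrelevant.
\<close>

definition sign_choice ::
    "'a graph \<Rightarrow> ('a \<Rightarrow> nat) \<Rightarrow> nat \<Rightarrow> (nat \<Rightarrow> 'a graph \<Rightarrow> 'a \<Rightarrow> int) \<Rightarrow> bool" where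
  "sign_choice \<Gamma> k p \<alpha> \<longleftrightarrow>
     (\<forall>t\<ge>1. \<forall>\<Delta>. subgraph \<Delta> \<Gamma> \<and> graph_connected \<Delta> \<and> (\<exists>\<beta>. orienting_sign \<Delta> k p t \<beta>) \<longrightarrow>
        orienting_sign \<Delta> k p t (\<alpha> t \<Delta>) \<and> (bipartite \<Delta> \<longrightarrow> bipartitioning \<Delta> (\<alpha> t \<Delta>)))"


section \<open>Reductions and the groups \<open>D\<close>\<close>

text \<open>For \<open>e = {v, w}\<close> the product is \<open>k\<^sub>v k\<^sub>w\<close>.\<close>

definition edge_val :: "nat \<Rightarrow> ('a \<Rightarrow> nat) \<Rightarrow> 'a set \<Rightarrow> nat" where
  "edge_val p k e = multiplicity p (\<Prod>v\<in>e. k v)"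

definition Red :: "nat \<Rightarrow> enat \<Rightarrow> 'a graph \<Rightarrow> ('a \<Rightarrow> nat) \<Rightarrow> 'a graph" where
  "Red p r \<Gamma> k = Graph (verts \<Gamma>) {e \<in> edges \<Gamma>. \<not> r \<le> enat (edge_val p k e)}"

definition edge_boundary :: "'a graph \<Rightarrow> 'a graph \<Rightarrow> 'a set set" where
  "edge_boundary \<Gamma> \<Delta> = {e \<in> edges \<Gamma>. e \<notin> edges \<Delta> \<and> e \<inter> verts \<Delta> \<noteq> {}}"

definition m_val :: "nat \<Rightarrow> ('a \<Rightarrow> nat) \<Rightarrow> 'a graph \<Rightarrow> nat" where
  "m_val p k \<Delta> = Min ((\<lambda>v. multiplicity p (k v)) ` verts \<Delta>)"

text \<open>The infimum over the empty set is \<open>\<infinity>\<close>.\<close>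

definition r_val :: "nat \<Rightarrow> 'a graph \<Rightarrow> ('a \<Rightarrow> nat) \<Rightarrow> 'a graph \<Rightarrow> enat" where
  "r_val p \<Gamma> k \<Delta> = (INF e\<in>edge_boundary \<Gamma> \<Delta>. enat (edge_val p k e))"

text \<open>
  The inequality \<open>r(\<Delta>) - m(\<Delta>) \<ge> s - d\<close> is stated additively, to avoid truncated subtraction;
  here \<open>d < s\<close>.
\<close>

definition D_gens ::
    "'a graph \<Rightarrow> ('a \<Rightarrow> nat) \<Rightarrow> nat \<Rightarrow> (nat \<Rightarrow> 'a graph \<Rightarrow> 'a \<Rightarrow> int) \<Rightarrow> nat \<Rightarrow> nat \<Rightarrow> ('a \<Rightarrow> int) set" where
  "D_gens \<Gamma> k p \<alpha> s d = {cochain_mod \<Gamma> (p ^ s) (Div (\<alpha> (s - d) \<Delta>) k \<Delta>) | \<Delta>.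
     subgraph \<Delta> \<Gamma> \<and> graph_connected \<Delta> \<and>
     enat (m_val p k \<Delta> + (s - d)) \<le> r_val p \<Gamma> k \<Delta> \<and>
     component \<Delta> (Red p (r_val p \<Gamma> k \<Delta>) \<Gamma> k) \<and>
     orienting_sign \<Delta> k p (s - d) (\<alpha> (s - d) \<Delta>)}"

definition D ::
    "'a graph \<Rightarrow> ('a \<Rightarrow> nat) \<Rightarrow> nat \<Rightarrow> (nat \<Rightarrow> 'a graph \<Rightarrow> 'a \<Rightarrow> int) \<Rightarrow> nat \<Rightarrow> nat \<Rightarrow> ('a \<Rightarrow> int) set" where
  "D \<Gamma> k p \<alpha> s d = generate (C0 \<Gamma> (p ^ s)) (D_gens \<Gamma> k p \<alpha> s d)"

definition pD ::
    "'a graph \<Rightarrow> ('a \<Rightarrow> nat) \<Rightarrow> nat \<Rightarrow> (nat \<Rightarrow> 'a graph \<Rightarrow> 'a \<Rightarrow> int) \<Rightarrow> nat \<Rightarrow> nat \<Rightarrow> ('a \<Rightarrow> int) set" where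
  "pD \<Gamma> k p \<alpha> s d = (\<lambda>x. x [^]\<^bsub>C0 \<Gamma> (p ^ s)\<^esub> (p ^ d)) ` D \<Gamma> k p \<alpha> s d"

end

theory Submission
  imports Defs "HOL-Number_Theory.Cong"
begin

text \<open>
  A cochain \<open>x\<close> is a cocycle modulo \<open>p\<^sup>s\<close> when \<open>p\<^sup>s\<close> divides \<open>k\<^sub>w x\<^sub>v + k\<^sub>v x\<^sub>w\<close> for every edge
  \<open>{v, w}\<close>, that is, when the ``slope'' \<open>c\<^sub>v = x\<^sub>v / k\<^sub>v\<close> changes sign along every edge, up to a
  \<open>p\<close>-adic error that grows with the valuation of \<open>k\<^sub>v k\<^sub>w\<close>. Write \<open>a\<^sub>v\<close> for the valuation of
  \<open>k\<^sub>v\<close>.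

  Suppose that \<open>x\<close> is a unit at \<open>v\<close>, put \<open>m = a\<^sub>v\<close>, and let \<open>\<Delta>\<close> be the component of \<open>v\<close> after removal
  of the edges of valuation at least \<open>m + s\<close>. Along the remaining edges the relation is strong enough
  to determine the scaled slope \<open>p\<^sup>m c\<^sub>v\<close> modulo \<open>p\<close>, up to alternation of sign. Starting from the
  unit at \<open>v\<close> it follows that all scaled slopes on \<open>\<Delta>\<close> are units
  (\<open>cocycle_slope\<close>), hence that \<open>m\<close> is the least valuation on \<open>\<Delta>\<close>
  (\<open>weight_minimal_at_unit\<close>); and any cocycle that vanishes modulo \<open>p\<close> at \<open>v\<close> vanishes modulo \<open>p\<close>
  on all of \<open>\<Delta>\<close> (\<open>cocycle_rigidity\<close>). The last fact says that evaluation at \<open>v\<close> modulo \<open>p\<close> embeds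
  the cokernel \<open>CR\<close> of \<open>\<Delta>\<close> into \<open>\<int>/p\<close>; thus \<open>\<Delta>\<close> is oriented, and every cocycle that is a unit at \<open>v\<close>
  is an orientation class (\<open>orientation_class_by_coordinate\<close>).

  The slopes also provide the signs (\<open>exists_sign_cocycle\<close>). For odd \<open>p\<close> let \<open>\<alpha>(u)\<close> say in which
  half of the nonzero residues the scaled slope at \<open>u\<close> lies: this alternates along edges, so
  \<open>Div\<close> is even an integral cocycle. For \<open>p = 2\<close> take residues modulo 4 instead.
  They alternate along all edges except possibly those of valuation exactly \<open>m + s - 1\<close>, and there
  the parity of a sum of two signs supplies the one missing factor 2.

  Since the edge boundary of \<open>\<Delta>\<close> has valuation at least \<open>m + s\<close>, the cochain \<open>Div\<close> of \<open>\<Delta>\<close> is one of the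
  generators with \<open>d = 0\<close> (\<open>exists_admissible\<close>). Subtracting a suitable multiple of it makes \<open>x\<close>
  vanish modulo \<open>p\<close> on \<open>\<Delta>\<close> and does not change \<open>x\<close> elsewhere, so after finitely many steps
  \<open>x = p y\<close> with a cocycle \<open>y\<close> modulo \<open>p\<^sup>s\<^sup>-\<^sup>1\<close>. The generators depend on \<open>s\<close> and \<open>d\<close> only through
  \<open>s - d\<close>, hence multiplication by \<open>p\<close> carries \<open>p\<^sup>d\<close> times a generator modulo \<open>p\<^sup>s\<^sup>-\<^sup>1\<close> to
  \<open>p\<^sup>d\<^sup>+\<^sup>1\<close> times a generator modulo \<open>p\<^sup>s\<close>, and induction on \<open>s\<close> finishes the argument (\<open>cocycle_induct\<close>).
\<close>

section \<open>Divisibility by powers of a prime\<close>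

text \<open>
  The form in which edge relations lose precision: dividing by a weight of valuation at most \<open>a\<close>
  costs at most \<open>a\<close> factors \<open>p\<close>.
\<close>

lemma prime_power_dvd_cancel:
  fixes k p a b :: nat and y :: int
  assumes "prime p" "0 < k" "multiplicity p k \<le> a" "int p ^ (a + b) dvd int k * y"
  shows "int p ^ b dvd y"
proof -
  have "\<not> is_unit p" "k \<noteq> 0"
    using assms(1,2) by auto
  then obtain \<kappa> where \<kappa>: "k = p ^ multiplicity p k * \<kappa>" "\<not> p dvd \<kappa>"
    using multiplicity_decompose'[of k p] by metis
  define c where "c = multiplicity p k"
  have "int p ^ (c + b) dvd int p ^ (a + b)"
    using assms(3) by (simp add: c_def le_imp_power_dvd)
  then have "int p ^ (c + b) dvd int k * y"
    using assms(4) dvd_trans by blast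
  also have "int k * y = int p ^ c * (int \<kappa> * y)"
    by (subst \<kappa>(1)) (simp add: c_def)
  finally have "int p ^ c * int p ^ b dvd int p ^ c * (int \<kappa> * y)"
    by (simp add: power_add)
  then have "int p ^ b dvd int \<kappa> * y"
    using assms(1) by (auto simp: prime_gt_0_nat)
  moreover have "coprime p \<kappa>"
    using assms(1) \<kappa>(2) prime_imp_coprime_nat by blast
  then have "coprime (int p ^ b) (int \<kappa>)"
    by simp
  ultimately show ?thesis
    using coprime_dvd_mult_right_iff by blast
qed

lemma prime_power_dvd_weight:
  assumes "a \<le> multiplicity p k"
  shows "int p ^ a dvd int k"
proof -
  have "p ^ a dvd k"
    using assms multiplicity_dvd' by blast
  then have "int (p ^ a) dvd int k"
    by presburger
  then show ?thesis
    by simp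
qed

text \<open>
  A \<open>p\<close>-adic quotient \<open>z / k\<close>, approximated by an integer: the part of \<open>k\<close> prime to \<open>p\<close> is invertible
  modulo \<open>p\<^sup>N\<close>.
\<close>

lemma quotient_by_weight:
  fixes k p N :: nat and z :: int
  assumes "prime p" "0 < k" "int p ^ multiplicity p k dvd z"
  shows "\<exists>c. int p ^ N dvd z - int k * c"
proof -
  have "\<not> is_unit p" "k \<noteq> 0"
    using assms(1,2) by auto
  then obtain \<kappa> where \<kappa>: "k = p ^ multiplicity p k * \<kappa>" "\<not> p dvd \<kappa>"
    using multiplicity_decompose'[of k p] by metis
  define a where "a = multiplicity p k"
  obtain z' where z': "z = int p ^ a * z'"
    using assms(3) by (auto simp: a_def)
  have "coprime p \<kappa>"
    using assms(1) \<kappa>(2) prime_imp_coprime_nat by blast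
  then have "coprime (int \<kappa>) (int p ^ N)"
    by (simp add: coprime_commute)
  then obtain u where "[int \<kappa> * u = 1] (mod int p ^ N)"
    using cong_solve_coprime_int by blast
  then have "int p ^ N dvd 1 - int \<kappa> * u"
    by (simp add: cong_iff_dvd_diff dvd_diff_commute)
  then have "int p ^ N dvd (int p ^ a * z') * (1 - int \<kappa> * u)"
    by simp
  also have "(int p ^ a * z') * (1 - int \<kappa> * u) = z - int k * (z' * u)"
  proof -
    have "int k = int p ^ a * int \<kappa>"
      by (subst \<kappa>(1)) (simp add: a_def)
    then show ?thesis
      by (simp add: z' algebra_simps)
  qed
  finally show ?thesis
    by blast
qed

lemma exists_multiple_mod_prime:
  fixes z y :: int
  assumes "prime p" "\<not> int p dvd z"
  obtains c :: nat where "int p dvd y - int c * z"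
proof -
  have "coprime z (int p)"
    using assms prime_imp_coprime[of "int p" z] by (simp add: coprime_commute)
  then obtain u where "[z * u = 1] (mod int p)"
    using cong_solve_coprime_int by blast
  then have "[z * u * y = 1 * y] (mod int p)"
    by (rule cong_mult) simp
  then have "[y = (u * y) * z] (mod int p)"
    by (simp add: cong_sym mult_ac)
  also have "[(u * y) * z = (u * y mod int p) * z] (mod int p)"
    by (intro cong_mult) (simp_all add: cong_def)
  also have "u * y mod int p = int (nat (u * y mod int p))"
    using assms(1) by (simp add: prime_gt_0_nat)
  finally have "int p dvd y - int (nat (u * y mod int p)) * z"
    by (simp only: cong_iff_dvd_diff)
  then show thesis
    by (rule that)
qed

section \<open>Connected subgraphs and components of reductions\<close>

lemma simple_graph_edge:
  assumes "simple_graph \<Gamma>" "{v, w} \<in> edges \<Gamma>"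
  shows "v \<in> verts \<Gamma>" "w \<in> verts \<Gamma>" "v \<noteq> w"
proof -
  obtain v' w' where "v' \<in> verts \<Gamma>" "w' \<in> verts \<Gamma>" "v' \<noteq> w'" "{v, w} = {v', w'}"
    using assms unfolding simple_graph_def by blast
  then show "v \<in> verts \<Gamma>" "w \<in> verts \<Gamma>" "v \<noteq> w"
    by (auto simp: doubleton_eq_iff)
qed

lemma simple_graph_edgeE:
  assumes "simple_graph \<Gamma>" "e \<in> edges \<Gamma>"
  obtains v w where "e = {v, w}"
  using assms unfolding simple_graph_def by blast

lemma connected_induct [consumes 3, case_names base step]:
  assumes "graph_connected \<Delta>" "v \<in> verts \<Delta>" "u \<in> verts \<Delta>"
    and base: "Q v"
    and step: "\<And>u w. {u, w} \<in> edges \<Delta> \<Longrightarrow> Q u \<Longrightarrow> Q w"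
  shows "Q u"
proof -
  have "(v, u) \<in> {(x, y). {x, y} \<in> edges \<Delta>}\<^sup>*"
    using assms(1,2,3) by (auto simp: graph_connected_def)
  then show ?thesis
    by (induction rule: rtrancl_induct) (auto intro: base step)
qed

text \<open>
  Components are recognised by closure under incident edges, which avoids the quantification over
  all larger connected subgraphs.
\<close>

lemma closed_connected_imp_component:
  assumes G: "simple_graph G" and sub: "subgraph \<Delta> G" and conn: "graph_connected \<Delta>"
    and closed: "\<And>e. e \<in> edges G \<Longrightarrow> e \<inter> verts \<Delta> \<noteq> {} \<Longrightarrow> e \<in> edges \<Delta>"
  shows "component \<Delta> G"
  unfolding component_def
proof (intro conjI allI impI)
  fix \<Delta>' assume "subgraph \<Delta>' G \<and> graph_connected \<Delta>' \<and> subgraph \<Delta> \<Delta>'"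
  then have \<Delta>': "subgraph \<Delta>' G" "graph_connected \<Delta>'" "subgraph \<Delta> \<Delta>'"
    by auto
  obtain v where v: "v \<in> verts \<Delta>"
    using conn by (auto simp: graph_connected_def)
  have "u \<in> verts \<Delta>" if "u \<in> verts \<Delta>'" for u
  proof -
    have "v \<in> verts \<Delta>'"
      using v \<Delta>'(3) by (auto simp: subgraph_def)
    from \<Delta>'(2) this that show ?thesis
    proof (induction rule: connected_induct)
      case (step u w)
      then have "{u, w} \<in> edges \<Delta>"
        using closed[of "{u, w}"] \<Delta>'(1) by (auto simp: subgraph_def)
      then show ?case
        using sub simple_graph_edge(2) by (auto simp: subgraph_def)
    qed (rule v)
  qed
  then have V: "verts \<Delta>' = verts \<Delta>"
    using \<Delta>'(3) by (auto simp: subgraph_def)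
  have "e \<in> edges \<Delta>" if e: "e \<in> edges \<Delta>'" for e
  proof -
    obtain u w where uw: "e = {u, w}"
      using \<Delta>'(1) e simple_graph_edgeE unfolding subgraph_def by metis
    then have "u \<in> verts \<Delta>"
      using simple_graph_edge(1)[of \<Delta>' u w] e V \<Delta>'(1) by (auto simp: subgraph_def)
    then show ?thesis
      using closed[of e] e uw \<Delta>'(1) by (auto simp: subgraph_def)
  qed
  then have "edges \<Delta>' = edges \<Delta>"
    using \<Delta>'(3) by (auto simp: subgraph_def)
  with V show "\<Delta>' = \<Delta>"
    by (simp add: graph.expand)
qed (use sub conn in auto)

lemma exists_closed_connected_subgraph:
  assumes G: "simple_graph G" and v: "v \<in> verts G"
  obtains \<Delta> where "subgraph \<Delta> G" "graph_connected \<Delta>" "v \<in> verts \<Delta>"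
    "\<And>e. e \<in> edges G \<Longrightarrow> e \<inter> verts \<Delta> \<noteq> {} \<Longrightarrow> e \<in> edges \<Delta>"
proof
  define r where "r = {(x, y). {x, y} \<in> edges G}"
  define V where "V = {u. (v, u) \<in> r\<^sup>*}"
  define \<Delta> where "\<Delta> = Graph V {e \<in> edges G. e \<subseteq> V}"
  have "sym r"
    by (auto simp: r_def sym_def insert_commute)
  have VG: "V \<subseteq> verts G"
  proof
    fix u assume "u \<in> V"
    then have "(v, u) \<in> r\<^sup>*"
      by (simp add: V_def)
    then show "u \<in> verts G"
      by (induction rule: rtrancl_induct) (use v simple_graph_edge[OF G] in \<open>auto simp: r_def\<close>)
  qed
  have step: "w \<in> V" if "u \<in> V" "{u, w} \<in> edges G" for u w
    using that by (auto simp: V_def r_def intro: rtrancl_into_rtrancl)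
  have fin: "finite V"
    using VG G finite_subset by (auto simp: simple_graph_def)
  show "subgraph \<Delta> G"
    using VG fin G unfolding subgraph_def simple_graph_def \<Delta>_def by fastforce
  have "(u, w) \<in> {(x, y). {x, y} \<in> edges \<Delta>}\<^sup>*" if "u \<in> V" "w \<in> V" for u w
  proof -
    have "(u, v) \<in> r\<^sup>*"
      using \<open>u \<in> V\<close> sym_rtrancl[OF \<open>sym r\<close>] by (auto simp: V_def sym_def)
    moreover have "(v, w) \<in> r\<^sup>*"
      using \<open>w \<in> V\<close> by (simp add: V_def)
    ultimately have "(u, w) \<in> r\<^sup>*"
      by (rule rtrancl_trans)
    then have "w \<in> V \<and> (u, w) \<in> {(x, y). {x, y} \<in> edges \<Delta>}\<^sup>*"
    proof (induction rule: rtrancl_induct)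
      case (step y z)
      then have "z \<in> V" "{y, z} \<in> edges \<Delta>"
        using \<open>\<And>u w. u \<in> V \<Longrightarrow> {u, w} \<in> edges G \<Longrightarrow> w \<in> V\<close>[of y z]
        by (auto simp: r_def \<Delta>_def)
      with step show ?case
        by (auto intro: rtrancl_into_rtrancl)
    qed (use \<open>u \<in> V\<close> in auto)
    then show ?thesis ..
  qed
  then show "graph_connected \<Delta>"
    by (auto simp: graph_connected_def \<Delta>_def V_def)
  show "v \<in> verts \<Delta>"
    by (simp add: \<Delta>_def V_def)
  show "e \<in> edges \<Delta>" if e: "e \<in> edges G" "e \<inter> verts \<Delta> \<noteq> {}" for e
  proof -
    obtain u w where uw: "e = {u, w}"
      using G e simple_graph_edgeE by metis
    with e(2) have "u \<in> V \<or> w \<in> V"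
      by (auto simp: \<Delta>_def)
    then have "u \<in> V \<and> w \<in> V"
      using step[of u w] step[of w u] e(1) uw by (auto simp: insert_commute)
    then show ?thesis
      using e(1) uw by (simp add: \<Delta>_def)
  qed
qed

lemma simple_graph_Red: "simple_graph \<Gamma> \<Longrightarrow> simple_graph (Red p R \<Gamma> k)"
  by (auto simp: simple_graph_def Red_def)

lemma negative_color_scheme_subgraph:
  "negative_color_scheme \<Gamma> k \<Longrightarrow> subgraph \<Delta> \<Gamma> \<Longrightarrow> negative_color_scheme \<Delta> k"
  by (auto simp: negative_color_scheme_def subgraph_def)

lemma edge_val_eq:
  assumes "negative_color_scheme \<Gamma> k" "prime p" "{v, w} \<in> edges \<Gamma>"
  shows "edge_val p k {v, w} = multiplicity p (k v) + multiplicity p (k w)"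
proof -
  have "v \<noteq> w" "0 < k v" "0 < k w"
    using assms simple_graph_edge[of \<Gamma> v w] by (auto simp: negative_color_scheme_def)
  then show ?thesis
    using assms(2) by (simp add: edge_val_def prime_elem_multiplicity_mult_distrib)
qed

text \<open>
  Cutting at a level \<open>M\<close> gives a component \<open>\<Delta>\<close> whose own level \<open>r(\<Delta>)\<close> may be larger than \<open>M\<close>. No
  edge meeting \<open>\<Delta>\<close> has a valuation between the two, so cutting at \<open>r(\<Delta>)\<close> gives the same component.
\<close>

lemma exists_boundary_bounded_component:
  assumes "simple_graph \<Gamma>" "v \<in> verts \<Gamma>"
  obtains \<Delta> where "subgraph \<Delta> \<Gamma>" "graph_connected \<Delta>" "v \<in> verts \<Delta>"
    "\<And>e. e \<in> edges \<Delta> \<Longrightarrow> edge_val p k e < M"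
    "enat M \<le> r_val p \<Gamma> k \<Delta>"
    "component \<Delta> (Red p (r_val p \<Gamma> k \<Delta>) \<Gamma> k)"
proof -
  have "v \<in> verts (Red p (enat M) \<Gamma> k)"
    using assms(2) by (simp add: Red_def)
  then obtain \<Delta> where \<Delta>: "subgraph \<Delta> (Red p (enat M) \<Gamma> k)" "graph_connected \<Delta>" "v \<in> verts \<Delta>"
    "\<And>e. e \<in> edges (Red p (enat M) \<Gamma> k) \<Longrightarrow> e \<inter> verts \<Delta> \<noteq> {} \<Longrightarrow> e \<in> edges \<Delta>"
    using exists_closed_connected_subgraph[OF simple_graph_Red[OF assms(1)]] by metis
  have val: "edge_val p k e < M" if "e \<in> edges \<Delta>" for e
    using that \<Delta>(1) by (auto simp: subgraph_def Red_def)
  have sub: "subgraph \<Delta> \<Gamma>"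
    using \<Delta>(1) by (auto simp: subgraph_def Red_def)
  have r: "enat M \<le> r_val p \<Gamma> k \<Delta>"
    unfolding r_val_def
  proof (rule INF_greatest)
    fix e assume e: "e \<in> edge_boundary \<Gamma> \<Delta>"
    then have "e \<notin> edges (Red p (enat M) \<Gamma> k)"
      using \<Delta>(4)[of e] by (auto simp: edge_boundary_def)
    then show "enat M \<le> enat (edge_val p k e)"
      using e by (simp add: Red_def edge_boundary_def)
  qed
  have "component \<Delta> (Red p (r_val p \<Gamma> k \<Delta>) \<Gamma> k)"
  proof (rule closed_connected_imp_component)
    have "enat (edge_val p k e) < r_val p \<Gamma> k \<Delta>" if "e \<in> edges \<Delta>" for e
      using val[OF that] r by (metis enat_ord_simps(2) less_le_trans)
    then show "subgraph \<Delta> (Red p (r_val p \<Gamma> k \<Delta>) \<Gamma> k)"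
      using sub by (force simp: subgraph_def Red_def)
    fix e assume e: "e \<in> edges (Red p (r_val p \<Gamma> k \<Delta>) \<Gamma> k)" "e \<inter> verts \<Delta> \<noteq> {}"
    show "e \<in> edges \<Delta>"
    proof (rule ccontr)
      assume "e \<notin> edges \<Delta>"
      then have "e \<in> edge_boundary \<Gamma> \<Delta>"
        using e by (auto simp: edge_boundary_def Red_def)
      then have "r_val p \<Gamma> k \<Delta> \<le> enat (edge_val p k e)"
        unfolding r_val_def by (rule INF_lower)
      then show False
        using e(1) by (simp add: Red_def)
    qed
  qed (use assms(1) simple_graph_Red \<Delta>(2) in auto)
  with that \<Delta> val sub r show thesis
    by blast
qed

section \<open>Cocycles on a connected subgraph\<close>

text \<open>
  The cocycle condition for integral cochains. Working with integers postpones the reduction modulo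
  \<open>n\<close>, so that one cochain can be considered for several moduli.
\<close>

definition cocycle :: "'a graph \<Rightarrow> ('a \<Rightarrow> nat) \<Rightarrow> nat \<Rightarrow> ('a \<Rightarrow> int) \<Rightarrow> bool" where
  "cocycle \<Gamma> k n x \<longleftrightarrow>
     (\<forall>v w. {v, w} \<in> edges \<Gamma> \<longrightarrow> int n dvd x v * int (k w) + x w * int (k v))"

lemma cocycleD:
  "cocycle \<Gamma> k n x \<Longrightarrow> {v, w} \<in> edges \<Gamma> \<Longrightarrow> int n dvd x v * int (k w) + x w * int (k v)"
  by (simp add: cocycle_def)

lemma cocycle_subgraph: "cocycle \<Gamma> k n x \<Longrightarrow> subgraph \<Delta> \<Gamma> \<Longrightarrow> cocycle \<Delta> k n x"
  by (auto simp: cocycle_def subgraph_def)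

lemma cocycle_cong_mod:
  assumes "simple_graph \<Gamma>" "\<And>v. v \<in> verts \<Gamma> \<Longrightarrow> int n dvd x v - y v" "cocycle \<Gamma> k n x"
  shows "cocycle \<Gamma> k n y"
  unfolding cocycle_def
proof (intro allI impI)
  fix v w assume e: "{v, w} \<in> edges \<Gamma>"
  have "int n dvd (x v - y v) * int (k w) + (x w - y w) * int (k v)"
    using assms(2) simple_graph_edge[OF assms(1) e] by simp
  with cocycleD[OF assms(3) e]
  have "int n dvd (x v * int (k w) + x w * int (k v)) - ((x v - y v) * int (k w) + (x w - y w) * int (k v))"
    by (rule dvd_diff)
  then show "int n dvd y v * int (k w) + y w * int (k v)"
    by (simp add: algebra_simps)
qed

lemma cocycle_add_multiple:
  assumes "cocycle \<Gamma> k n x" "cocycle \<Gamma> k n y"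
  shows "cocycle \<Gamma> k n (\<lambda>v. x v + c * y v)"
  unfolding cocycle_def
proof (intro allI impI)
  fix v w assume e: "{v, w} \<in> edges \<Gamma>"
  have "int n dvd (x v * int (k w) + x w * int (k v)) + c * (y v * int (k w) + y w * int (k v))"
    using cocycleD[OF assms(1) e] cocycleD[OF assms(2) e] by simp
  then show "int n dvd (x v + c * y v) * int (k w) + (x w + c * y w) * int (k v)"
    by (simp add: algebra_simps)
qed

lemma cocycle_mult_iff:
  assumes "0 < a"
  shows "cocycle \<Gamma> k (a * n) (\<lambda>v. int a * x v) \<longleftrightarrow> cocycle \<Gamma> k n x"
proof -
  have "int (a * n) dvd int a * x v * int (k w) + int a * x w * int (k v) \<longleftrightarrow>
     int n dvd x v * int (k w) + x w * int (k v)" for v w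
  proof -
    have "int a * x v * int (k w) + int a * x w * int (k v) = int a * (x v * int (k w) + x w * int (k v))"
      by (simp add: algebra_simps)
    with assms show ?thesis
      by simp
  qed
  then show ?thesis
    by (simp add: cocycle_def)
qed

text \<open>
  The integer \<open>c\<close> approximates the slope \<open>x\<^sub>u / k\<^sub>u\<close>, scaled by \<open>p\<^sup>m\<close>. It is a unit at \<open>v\<close> because \<open>x\<^sub>v\<close> is
  one and \<open>m\<close> is the valuation of \<open>k\<^sub>v\<close>. An edge \<open>{u, w}\<close> gives \<open>c\<^sub>u + c\<^sub>w \<equiv> 0\<close> modulo
  \<open>p\<^sup>m\<^sup>+\<^sup>t\<close> divided by the \<open>p\<close>-part of \<open>k\<^sub>u k\<^sub>w\<close>; the bound on the valuations of edges leaves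
  at least one factor \<open>p\<close>, so units propagate. That the slope at \<open>w\<close> is \<open>p\<close>-integral comes from
  the same relation.
\<close>

lemma cocycle_slope:
  assumes scheme: "negative_color_scheme \<Delta> k" and p: "prime p" and "1 \<le> t"
    and conn: "graph_connected \<Delta>" and v: "v \<in> verts \<Delta>"
    and val: "\<And>e. e \<in> edges \<Delta> \<Longrightarrow> edge_val p k e < multiplicity p (k v) + t"
    and x: "cocycle \<Delta> k (p ^ t) x" "\<not> int p dvd x v"
    and u: "u \<in> verts \<Delta>"
  defines "m \<equiv> multiplicity p (k v)"
  shows "\<exists>c. \<not> int p dvd c \<and> int p ^ (m + t) dvd int p ^ m * x u - int (k u) * c"
  using conn v u
proof (induction rule: connected_induct)
  case base
  have kv: "0 < k v"
    using scheme v by (simp add: negative_color_scheme_def)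
  then obtain c where c: "int p ^ (m + t) dvd int p ^ m * x v - int (k v) * c"
    using quotient_by_weight[OF p kv, of "int p ^ m * x v" "m + t"] by (auto simp: m_def)
  have "\<not> int p dvd c"
  proof
    assume "int p dvd c"
    moreover have "int p ^ m dvd int (k v)"
      by (simp add: m_def prime_power_dvd_weight)
    ultimately have "int p ^ (m + 1) dvd int (k v) * c"
      by (simp add: mult_dvd_mono mult.commute)
    moreover have "int p ^ (m + 1) dvd int p ^ (m + t)"
      using \<open>1 \<le> t\<close> by (intro le_imp_power_dvd) simp
    then have "int p ^ (m + 1) dvd int p ^ m * x v - int (k v) * c"
      using c dvd_trans by blast
    ultimately have "int p ^ (m + 1) dvd (int p ^ m * x v - int (k v) * c) + int (k v) * c"
      by (intro dvd_add)
    then have "int p ^ m * int p dvd int p ^ m * x v"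
      by simp
    then show False
      using x(2) p by (auto simp: prime_gt_0_nat)
  qed
  with c show ?case
    by blast
next
  case (step u w)
  obtain c where c: "\<not> int p dvd c" "int p ^ (m + t) dvd int p ^ m * x u - int (k u) * c"
    using step by blast
  define a b where "a = multiplicity p (k u)" and "b = multiplicity p (k w)"
  have ku: "0 < k u" and kw: "0 < k w"
    using scheme step(1) simple_graph_edge[of \<Delta> u w] by (auto simp: negative_color_scheme_def)
  have ab: "a + b < m + t"
    using val[OF step(1)] edge_val_eq[OF scheme p step(1)] by (simp add: a_def b_def m_def)
  have "int p ^ t dvd x u * int (k w) + x w * int (k u)"
    using cocycleD[OF x(1) step(1)] by simp
  then have "int p ^ (m + t) dvd int p ^ m * (x u * int (k w) + x w * int (k u))"
    by (simp add: power_add)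
  moreover have "int p ^ (m + t) dvd int (k w) * (int p ^ m * x u - int (k u) * c)"
    using c(2) by simp
  ultimately have "int p ^ (m + t) dvd int p ^ m * (x u * int (k w) + x w * int (k u))
      - int (k w) * (int p ^ m * x u - int (k u) * c)"
    by (rule dvd_diff)
  also have "\<dots> = int (k u) * (int p ^ m * x w + int (k w) * c)"
    by (simp add: algebra_simps)
  finally have "int p ^ (a + (m + t - a)) dvd int (k u) * (int p ^ m * x w + int (k w) * c)"
    using ab by simp
  \<comment> \<open>Both terms of the relation at \<open>{u, w}\<close> are divided by \<open>k\<^sub>u\<close>; at least \<open>b + 1\<close> factors \<open>p\<close> remain.\<close>
  from prime_power_dvd_cancel[OF p ku _ this]
  have 1: "int p ^ (m + t - a) dvd int p ^ m * x w + int (k w) * c"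
    by (simp add: a_def)
  have bw: "int p ^ b dvd int (k w)"
    by (simp add: b_def prime_power_dvd_weight)
  have "int p ^ b dvd int p ^ (m + t - a)"
    using ab by (intro le_imp_power_dvd) simp
  then have "int p ^ b dvd int p ^ m * x w + int (k w) * c"
    using 1 dvd_trans by blast
  then have "int p ^ b dvd int p ^ m * x w"
    using bw by (simp add: dvd_add_left_iff)
  then obtain c' where c': "int p ^ (m + t) dvd int p ^ m * x w - int (k w) * c'"
    using quotient_by_weight[OF p kw] by (auto simp: b_def)
  have "int p ^ (m + t - a) dvd int p ^ (m + t)"
    by (intro le_imp_power_dvd) simp
  with c' have "int p ^ (m + t - a) dvd int p ^ m * x w - int (k w) * c'"
    using dvd_trans by blast
  with 1 have "int p ^ (m + t - a) dvd
      (int p ^ m * x w + int (k w) * c) - (int p ^ m * x w - int (k w) * c')"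
    by (rule dvd_diff)
  also have "\<dots> = int (k w) * (c + c')"
    by (simp add: algebra_simps)
  also have "m + t - a = b + (m + t - a - b)"
    using ab by simp
  finally have "int p ^ (b + (m + t - a - b)) dvd int (k w) * (c + c')" .
  from prime_power_dvd_cancel[OF p kw _ this] have "int p ^ (m + t - a - b) dvd c + c'"
    by (simp add: b_def)
  moreover have "int p dvd int p ^ (m + t - a - b)"
    using ab by (intro dvd_power) auto
  ultimately have "int p dvd c + c'"
    using dvd_trans by blast
  then have "\<not> int p dvd c'"
    using c(1) dvd_add_left_iff by blast
  with c' show ?case
    by blast
qed

text \<open>
  From \<open>p\<^sup>m x\<^sub>u \<equiv> k\<^sub>u c\<close> with a unit \<open>c\<close>, the power \<open>p\<^sup>m\<close> divides \<open>k\<^sub>u\<close>.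
\<close>

lemma weight_minimal_at_unit:
  assumes "negative_color_scheme \<Delta> k" "prime p" "1 \<le> t"
    and "graph_connected \<Delta>" "v \<in> verts \<Delta>"
    and "\<And>e. e \<in> edges \<Delta> \<Longrightarrow> edge_val p k e < multiplicity p (k v) + t"
    and "cocycle \<Delta> k (p ^ t) x" "\<not> int p dvd x v"
    and u: "u \<in> verts \<Delta>"
  shows "multiplicity p (k v) \<le> multiplicity p (k u)"
proof -
  define m where "m = multiplicity p (k v)"
  obtain c where c: "\<not> int p dvd c" "int p ^ (m + t) dvd int p ^ m * x u - int (k u) * c"
    using cocycle_slope[OF assms] by (auto simp: m_def)
  have "int p ^ m dvd int p ^ m * x u - int (k u) * c"
    using c(2) by (metis dvd_trans le_add1 le_imp_power_dvd)
  then have "int p ^ m dvd int p ^ m * x u - (int p ^ m * x u - int (k u) * c)"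
    by (rule dvd_diff[OF dvd_triv_left])
  then have "int p ^ m dvd c * int (k u)"
    by (simp add: mult.commute)
  moreover have "coprime (int p ^ m) c"
    using c(1) assms(2) by (simp add: prime_imp_coprime)
  ultimately have "int p ^ m dvd int (k u)"
    using coprime_dvd_mult_right_iff by blast
  then have "p ^ m dvd k u"
    by (metis of_nat_dvd_iff of_nat_power)
  moreover have "0 < k u" "\<not> is_unit p"
    using assms(1,2) u by (auto simp: negative_color_scheme_def)
  ultimately show ?thesis
    by (simp add: m_def multiplicity_geI)
qed

text \<open>
  The same propagation for a cocycle whose scaled slope at \<open>v\<close> is divisible by \<open>p\<close>: so are then
  all scaled slopes, which by minimality of \<open>m\<close> forces \<open>p\<close> to divide the values themselves.
\<close>

lemma cocycle_rigidity:
  assumes scheme: "negative_color_scheme \<Delta> k" and p: "prime p"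
    and conn: "graph_connected \<Delta>" and v: "v \<in> verts \<Delta>"
    and min: "\<And>u. u \<in> verts \<Delta> \<Longrightarrow> m \<le> multiplicity p (k u)"
    and mv: "multiplicity p (k v) = m"
    and val: "\<And>e. e \<in> edges \<Delta> \<Longrightarrow> edge_val p k e < m + t"
    and y: "cocycle \<Delta> k (p ^ t) y" "int p dvd y v"
    and u: "u \<in> verts \<Delta>"
  shows "int p dvd y u"
proof -
  have "int p ^ (multiplicity p (k u) + 1) dvd int p ^ m * y u"
    using conn v u
  proof (induction rule: connected_induct)
    case base
    show ?case
      using y(2) by (simp add: mv mult_dvd_mono)
  next
    case (step u w)
    define a b where "a = multiplicity p (k u)" and "b = multiplicity p (k w)"
    have ku: "0 < k u"
      using scheme step(1) simple_graph_edge[of \<Delta> u w] by (auto simp: negative_color_scheme_def)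
    have ab: "a + b < m + t"
      using val[OF step(1)] edge_val_eq[OF scheme p step(1)] by (simp add: a_def b_def)
    have "int p ^ t dvd y u * int (k w) + y w * int (k u)"
      using cocycleD[OF y(1) step(1)] by simp
    then have "int p ^ (m + t) dvd int p ^ m * (y u * int (k w) + y w * int (k u))"
      by (simp add: power_add)
    moreover have "int p ^ (a + (b + 1)) dvd int p ^ (m + t)"
      using ab by (intro le_imp_power_dvd) simp
    ultimately have "int p ^ (a + (b + 1)) dvd int p ^ m * (y u * int (k w) + y w * int (k u))"
      using dvd_trans by blast
    moreover have "int p ^ (a + 1) * int p ^ b dvd (int p ^ m * y u) * int (k w)"
      using step(2) by (intro mult_dvd_mono prime_power_dvd_weight) (simp_all add: a_def b_def)
    then have "int p ^ (a + (b + 1)) dvd (int p ^ m * y u) * int (k w)"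
      by (simp add: power_add mult_ac)
    ultimately have "int p ^ (a + (b + 1)) dvd int p ^ m * (y u * int (k w) + y w * int (k u))
        - (int p ^ m * y u) * int (k w)"
      by (rule dvd_diff)
    also have "\<dots> = int (k u) * (int p ^ m * y w)"
      by (simp add: algebra_simps)
    finally have "int p ^ (a + (b + 1)) dvd int (k u) * (int p ^ m * y w)" .
    from prime_power_dvd_cancel[OF p ku _ this] have "int p ^ (b + 1) dvd int p ^ m * y w"
      by (simp add: a_def)
    then show ?case
      by (simp add: b_def)
  qed
  moreover have "int p ^ (m + 1) dvd int p ^ (multiplicity p (k u) + 1)"
    using min[OF u] by (intro le_imp_power_dvd) simp
  ultimately have "int p ^ m * int p dvd int p ^ m * y u"
    using dvd_trans by fastforce
  then show ?thesis
    using p by (auto simp: prime_gt_0_nat)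
qed

section \<open>Signs and the cochains Div\<close>

text \<open>
  The sign of the representative of \<open>c\<close> of least absolute value modulo \<open>q\<close>. It is an odd function of the
  residue, apart from the residues \<open>0\<close> and \<open>q / 2\<close>, which are fixed by negation.
\<close>

definition half_sign :: "int \<Rightarrow> int \<Rightarrow> int" where
  "half_sign q c = (if 2 * (c mod q) < q then 1 else -1)"

text \<open>
  For \<open>p = 2\<close> the modulus 2 would be useless, since every odd residue is its own negative;
  modulo 4 the odd residues are again exchanged by negation.
\<close>

lemma half_sign_cancel:
  assumes p: "prime p" and q: "q = (if p = 2 then 4 else int p)"
    and "\<not> int p dvd c" "q dvd c + c'"
  shows "half_sign q c + half_sign q c' = 0"
proof -
  have "0 < q"
    using q prime_gt_0_nat[OF p] by auto
  have "int p dvd q"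
    using q by auto
  then have c0: "c mod q \<noteq> 0"
    using assms(3) dvd_trans by blast
  have "c mod q + c' mod q = q"
  proof -
    have "q dvd c mod q + c' mod q"
      using assms(4) by (metis mod_add_eq dvd_eq_mod_eq_0 mod_mod_trivial)
    moreover have "0 < c mod q + c' mod q" "c mod q + c' mod q < 2 * q"
      using \<open>0 < q\<close> c0 pos_mod_bound[of q c] pos_mod_bound[of q c'] pos_mod_sign[of q c] pos_mod_sign[of q c']
      by linarith+
    moreover obtain j where j: "c mod q + c' mod q = q * j"
      using calculation(1) by (elim dvdE)
    ultimately have "0 < q * j" "q * j < q * 2"
      by (simp_all add: mult.commute)
    then have "0 < j" "j < 2"
      using \<open>0 < q\<close> by (auto simp: zero_less_mult_iff)
    then show ?thesis
      using j by simp
  qed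
  moreover have "2 * (c mod q) \<noteq> q"
  proof (cases "p = 2")
    case True
    have "odd (c mod q)"
      using assms(3) True q by (simp add: dvd_mod_iff)
    then have "c mod q \<noteq> 2"
      by auto
    then show ?thesis
      using True q by auto
  next
    case False
    then have "odd q"
      using q p prime_odd_nat[of p] prime_ge_2_nat[of p] by auto
    then show ?thesis
      by (metis dvd_triv_left)
  qed
  ultimately show ?thesis
    by (auto simp: half_sign_def)
qed

lemma m_val_eqI:
  assumes "simple_graph \<Delta>" "v \<in> verts \<Delta>"
    and "\<And>u. u \<in> verts \<Delta> \<Longrightarrow> multiplicity p (k v) \<le> multiplicity p (k u)"
  shows "m_val p k \<Delta> = multiplicity p (k v)"
  unfolding m_val_def using assms by (intro Min_eqI) (auto simp: simple_graph_def)

lemma m_val_attained: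
  assumes "simple_graph \<Delta>" "verts \<Delta> \<noteq> {}"
  obtains v where "v \<in> verts \<Delta>" "multiplicity p (k v) = m_val p k \<Delta>"
proof -
  have "m_val p k \<Delta> \<in> (\<lambda>v. multiplicity p (k v)) ` verts \<Delta>"
    unfolding m_val_def using assms by (intro Min_in) (auto simp: simple_graph_def)
  with that show thesis
    by auto
qed

lemma gcd_weights_pos:
  assumes "negative_color_scheme \<Delta> k" "verts \<Delta> \<noteq> {}"
  shows "0 < Gcd (k ` verts \<Delta>)"
proof -
  obtain v where "v \<in> verts \<Delta>" "0 < k v"
    using assms by (auto simp: negative_color_scheme_def)
  then have "Gcd (k ` verts \<Delta>) dvd k v"
    by (intro Gcd_dvd) auto
  with \<open>0 < k v\<close> show ?thesis
    using dvd_pos_nat by blast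
qed

lemma multiplicity_gcd_weights:
  assumes "negative_color_scheme \<Delta> k" "prime p" "verts \<Delta> \<noteq> {}"
  shows "multiplicity p (Gcd (k ` verts \<Delta>)) \<le> m_val p k \<Delta>"
proof -
  obtain v where v: "v \<in> verts \<Delta>" "multiplicity p (k v) = m_val p k \<Delta>"
    using m_val_attained assms by (metis negative_color_scheme_def)
  then have "Gcd (k ` verts \<Delta>) dvd k v" "k v \<noteq> 0"
    using assms(1) by (auto intro: Gcd_dvd simp: negative_color_scheme_def)
  then show ?thesis
    using v(2) dvd_imp_multiplicity_le by metis
qed

lemma gcd_times_Div:
  "int (Gcd (k ` verts \<Delta>)) * Div \<alpha> k \<Delta> v = int (k v) * (if v \<in> verts \<Delta> then \<alpha> v else 0)"
proof (cases "v \<in> verts \<Delta>")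
  case True
  then have "Gcd (k ` verts \<Delta>) dvd k v"
    by (intro Gcd_dvd) auto
  then have "int (Gcd (k ` verts \<Delta>)) * int (k v div Gcd (k ` verts \<Delta>)) = int (k v)"
    by (metis dvd_mult_div_cancel of_nat_mult)
  then show ?thesis
    using True by (simp add: Div_def mult_ac)
qed (simp add: Div_def)

text \<open>
  After multiplication by the greatest common divisor \<open>g\<close> of the weights, \<open>Div\<close> has constant slope up to
  sign, so that its coboundary is \<open>k\<^sub>v k\<^sub>w\<close> times a sum of signs, divided by \<open>g\<close>. The extension by zero
  makes the same formula cover the boundary edges of \<open>\<Delta>\<close>.
\<close>

lemma Div_edge_dvd:
  fixes \<alpha> :: "'a \<Rightarrow> int"
  assumes "negative_color_scheme \<Delta> k" "prime p" "verts \<Delta> \<noteq> {}"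
  defines "\<epsilon> \<equiv> \<lambda>v. if v \<in> verts \<Delta> then \<alpha> v else 0"
  assumes "int p ^ (m_val p k \<Delta> + t) dvd int (k v) * int (k w) * (\<epsilon> v + \<epsilon> w)"
  shows "int p ^ t dvd Div \<alpha> k \<Delta> v * int (k w) + Div \<alpha> k \<Delta> w * int (k v)"
proof (rule prime_power_dvd_cancel)
  let ?g = "Gcd (k ` verts \<Delta>)"
  have "int ?g * (Div \<alpha> k \<Delta> v * int (k w) + Div \<alpha> k \<Delta> w * int (k v))
      = (int ?g * Div \<alpha> k \<Delta> v) * int (k w) + (int ?g * Div \<alpha> k \<Delta> w) * int (k v)"
    by (simp add: algebra_simps)
  also have "\<dots> = int (k v) * int (k w) * (\<epsilon> v + \<epsilon> w)"
    by (simp only: gcd_times_Div \<epsilon>_def) (simp add: algebra_simps)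
  finally show "int p ^ (m_val p k \<Delta> + t) dvd
      int ?g * (Div \<alpha> k \<Delta> v * int (k w) + Div \<alpha> k \<Delta> w * int (k v))"
    using assms(5) by simp
qed (rule assms(2), rule gcd_weights_pos[OF assms(1,3)], rule multiplicity_gcd_weights[OF assms(1-3)])

text \<open>
  Where the valuation of \<open>k\<^sub>v\<close> is minimal, \<open>k\<^sub>v / g\<close> is prime to \<open>p\<close>.
\<close>

lemma Div_unit:
  assumes scheme: "negative_color_scheme \<Delta> k" and p: "prime p" and v: "v \<in> verts \<Delta>"
    and "sign_function \<Delta> \<alpha>" and mv: "multiplicity p (k v) = m_val p k \<Delta>"
  shows "\<not> int p dvd Div \<alpha> k \<Delta> v"
proof
  let ?g = "Gcd (k ` verts \<Delta>)"
  assume "int p dvd Div \<alpha> k \<Delta> v"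
  then have "p dvd k v div ?g"
    using assms(4) v by (auto simp: Div_def sign_function_def)
  moreover have "p ^ m_val p k \<Delta> dvd ?g"
  proof (rule Gcd_greatest)
    fix n assume "n \<in> k ` verts \<Delta>"
    then have "m_val p k \<Delta> \<le> multiplicity p n"
      unfolding m_val_def using scheme
      by (intro Min_le) (auto simp: negative_color_scheme_def simple_graph_def)
    then show "p ^ m_val p k \<Delta> dvd n"
      by (rule multiplicity_dvd')
  qed
  ultimately have "p ^ m_val p k \<Delta> * p dvd ?g * (k v div ?g)"
    by (intro mult_dvd_mono)
  also have "?g * (k v div ?g) = k v"
    using v by (intro dvd_mult_div_cancel Gcd_dvd) auto
  finally have "p ^ Suc (m_val p k \<Delta>) dvd k v"
    by (simp add: mult.commute)
  moreover have "0 < k v" "\<not> is_unit p"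
    using scheme v p by (auto simp: negative_color_scheme_def)
  ultimately have "Suc (m_val p k \<Delta>) \<le> multiplicity p (k v)"
    by (intro multiplicity_geI) auto
  with mv show False
    by simp
qed

text \<open>
  The signs of the scaled slopes of any cocycle that is a unit at a single vertex already
  make \<open>Div\<close> a cocycle.
\<close>

lemma exists_sign_cocycle:
  assumes scheme: "negative_color_scheme \<Delta> k" and p: "prime p" and "1 \<le> t"
    and conn: "graph_connected \<Delta>" and v: "v \<in> verts \<Delta>"
    and val: "\<And>e. e \<in> edges \<Delta> \<Longrightarrow> edge_val p k e < multiplicity p (k v) + t"
    and x: "cocycle \<Delta> k (p ^ t) x" "\<not> int p dvd x v"
  obtains \<alpha> where "sign_function \<Delta> \<alpha>" "cocycle \<Delta> k (p ^ t) (Div \<alpha> k \<Delta>)"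
proof -
  define m where "m = multiplicity p (k v)"
  have simple: "simple_graph \<Delta>"
    using scheme by (simp add: negative_color_scheme_def)
  have m: "m_val p k \<Delta> = m"
    unfolding m_def by (intro m_val_eqI[OF simple v]) (rule weight_minimal_at_unit[OF assms])
  have "\<forall>u\<in>verts \<Delta>. \<exists>c. \<not> int p dvd c \<and> int p ^ (m + t) dvd int p ^ m * x u - int (k u) * c"
    using cocycle_slope[OF assms] by (simp add: m_def)
  then obtain c where c: "\<And>u. u \<in> verts \<Delta> \<Longrightarrow> \<not> int p dvd c u"
      "\<And>u. u \<in> verts \<Delta> \<Longrightarrow> int p ^ (m + t) dvd int p ^ m * x u - int (k u) * c u"
    by metis
  define q :: int where "q = (if p = 2 then 4 else int p)"
  define \<alpha> where "\<alpha> u = half_sign q (c u)" for u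
  have "cocycle \<Delta> k (p ^ t) (Div \<alpha> k \<Delta>)"
    unfolding cocycle_def
  proof (intro allI impI)
    fix u w assume e: "{u, w} \<in> edges \<Delta>"
    define a b where "a = multiplicity p (k u)" and "b = multiplicity p (k w)"
    have uw: "u \<in> verts \<Delta>" "w \<in> verts \<Delta>"
      using simple_graph_edge[OF simple e] by auto
    then have ku: "0 < k u" and kw: "0 < k w"
      using scheme by (auto simp: negative_color_scheme_def)
    have ab: "a + b < m + t"
      using val[OF e] edge_val_eq[OF scheme p e] by (simp add: a_def b_def m_def)
    have "int p ^ t dvd x u * int (k w) + x w * int (k u)"
      using cocycleD[OF x(1) e] by simp
    then have "int p ^ (m + t) dvd int p ^ m * (x u * int (k w) + x w * int (k u))"
      by (simp add: power_add)
    moreover have "int p ^ (m + t) dvd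
        int (k w) * (int p ^ m * x u - int (k u) * c u) + int (k u) * (int p ^ m * x w - int (k w) * c w)"
      using c(2) uw by simp
    ultimately have "int p ^ (m + t) dvd int p ^ m * (x u * int (k w) + x w * int (k u)) -
        (int (k w) * (int p ^ m * x u - int (k u) * c u) + int (k u) * (int p ^ m * x w - int (k w) * c w))"
      by (rule dvd_diff)
    also have "\<dots> = int (k u) * (int (k w) * (c u + c w))"
      by (simp add: algebra_simps)
    also have "m + t = a + (b + (m + t - a - b))"
      using ab by simp
    finally have "int p ^ (a + (b + (m + t - a - b))) dvd int (k u) * (int (k w) * (c u + c w))" .
    from prime_power_dvd_cancel[OF p ku _ this]
    have "int p ^ (b + (m + t - a - b)) dvd int (k w) * (c u + c w)"
      by (simp add: a_def)
    from prime_power_dvd_cancel[OF p kw _ this]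
    have cc: "int p ^ (m + t - a - b) dvd c u + c w"
      by (simp add: b_def)
    have "int p ^ (m + t) dvd int (k u) * int (k w) * (\<alpha> u + \<alpha> w)"
    proof (cases "q dvd c u + c w")
      case True
      then have "\<alpha> u + \<alpha> w = 0"
        unfolding \<alpha>_def using half_sign_cancel[OF p q_def c(1)[OF uw(1)]] by blast
      then show ?thesis
        by simp
    next
      case False
      \<comment> \<open>Here \<open>p = 2\<close> and the signs need not cancel; the missing factor 2 is the parity of their sum.\<close>
      have "p = 2"
      proof (rule ccontr)
        assume "p \<noteq> 2"
        moreover have "int p dvd int p ^ (m + t - a - b)"
          using ab by (intro dvd_power) auto
        ultimately show False
          using False cc dvd_trans by (auto simp: q_def)
      qed
      have "\<not> 2 \<le> m + t - a - b"
      proof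
        assume "2 \<le> m + t - a - b"
        then have "int p ^ 2 dvd int p ^ (m + t - a - b)"
          by (rule le_imp_power_dvd)
        then have "int p ^ 2 dvd c u + c w"
          using cc dvd_trans by blast
        then show False
          using False \<open>p = 2\<close> by (simp add: q_def)
      qed
      then have "m + t = a + b + 1"
        using ab by simp
      moreover have "int p dvd \<alpha> u + \<alpha> w"
        using \<open>p = 2\<close> by (auto simp: \<alpha>_def half_sign_def)
      moreover have "int p ^ a dvd int (k u)" "int p ^ b dvd int (k w)"
        by (simp_all add: a_def b_def prime_power_dvd_weight)
      ultimately show ?thesis
        by (simp only: power_add power_one_right mult_dvd_mono)
    qed
    then have "int p ^ t dvd Div \<alpha> k \<Delta> u * int (k w) + Div \<alpha> k \<Delta> w * int (k u)"
      using uw v by (intro Div_edge_dvd[OF scheme p]) (auto simp: m)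
    then show "int (p ^ t) dvd Div \<alpha> k \<Delta> u * int (k w) + Div \<alpha> k \<Delta> w * int (k u)"
      by simp
  qed
  moreover have "sign_function \<Delta> \<alpha>"
    by (simp add: sign_function_def \<alpha>_def half_sign_def)
  ultimately show thesis
    using that by blast
qed

section \<open>The groups of cochains and of cocycles\<close>

lemma carrier_C0: "0 < n \<Longrightarrow> carrier (C0 \<Gamma> n) = (\<Pi>\<^sub>E v\<in>verts \<Gamma>. {0..<int n})"
  by (simp add: C0_def carrier_integer_mod_group)

lemma group_C0: "group (C0 \<Gamma> n)"
  by (simp add: C0_def)

lemma comm_group_C0: "comm_group (C0 \<Gamma> n)"
  by (rule group.group_comm_groupI[OF group_C0]) (simp add: C0_def add.commute)

lemma cochain_mod_in_C0: "0 < n \<Longrightarrow> cochain_mod \<Gamma> n x \<in> carrier (C0 \<Gamma> n)"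
  by (simp add: carrier_C0 cochain_mod_def)

lemma cochain_mod_id: "0 < n \<Longrightarrow> x \<in> carrier (C0 \<Gamma> n) \<Longrightarrow> cochain_mod \<Gamma> n x = x"
  by (force simp: carrier_C0 cochain_mod_def PiE_iff extensional_def fun_eq_iff)

lemma cochain_mod_cong:
  "(\<And>v. v \<in> verts \<Gamma> \<Longrightarrow> int n dvd x v - y v) \<Longrightarrow> cochain_mod \<Gamma> n x = cochain_mod \<Gamma> n y"
  by (auto simp: cochain_mod_def fun_eq_iff mod_eq_dvd_iff)

lemma one_C0: "\<one>\<^bsub>C0 \<Gamma> n\<^esub> = cochain_mod \<Gamma> n (\<lambda>v. 0)"
  by (simp add: C0_def cochain_mod_def)

lemma mult_C0: "cochain_mod \<Gamma> n x \<otimes>\<^bsub>C0 \<Gamma> n\<^esub> cochain_mod \<Gamma> n y = cochain_mod \<Gamma> n (\<lambda>v. x v + y v)"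
  by (simp add: C0_def cochain_mod_def fun_eq_iff mod_add_eq)

lemma pow_C0: "cochain_mod \<Gamma> n x [^]\<^bsub>C0 \<Gamma> n\<^esub> (c :: nat) = cochain_mod \<Gamma> n (\<lambda>v. int c * x v)"
proof (induction c)
  case 0
  then show ?case
    by (simp add: one_C0 monoid.nat_pow_0 group.is_monoid group_C0)
next
  case (Suc c)
  then show ?case
    by (simp add: mult_C0 algebra_simps)
qed

lemma inv_C0:
  assumes "0 < n"
  shows "inv\<^bsub>C0 \<Gamma> n\<^esub> (cochain_mod \<Gamma> n x) = cochain_mod \<Gamma> n (\<lambda>v. - x v)"
  by (rule group.inv_equality[OF group_C0])
    (simp_all add: mult_C0 one_C0 cochain_mod_in_C0 assms)

lemma cocycle_cochain_mod_iff:
  assumes "simple_graph \<Gamma>" "m dvd n"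
  shows "cocycle \<Gamma> k m (cochain_mod \<Gamma> n x) \<longleftrightarrow> cocycle \<Gamma> k m x"
proof -
  have "int m dvd x v mod int n - x v" for v
  proof -
    have "int n dvd x v mod int n - x v"
      by (simp add: mod_eq_dvd_iff[symmetric])
    then show ?thesis
      using assms(2) by (meson dvd_trans of_nat_dvd_iff)
  qed
  then have *: "\<And>v. v \<in> verts \<Gamma> \<Longrightarrow> int m dvd cochain_mod \<Gamma> n x v - x v"
      "\<And>v. v \<in> verts \<Gamma> \<Longrightarrow> int m dvd x v - cochain_mod \<Gamma> n x v"
    by (auto simp: cochain_mod_def dvd_diff_commute)
  show ?thesis
    using cocycle_cong_mod[OF assms(1), of m "cochain_mod \<Gamma> n x" x]
      cocycle_cong_mod[OF assms(1), of m x "cochain_mod \<Gamma> n x"] * by blast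
qed

text \<open>
  The modulus \<open>n\<close> of the coefficients may be a multiple of the modulus \<open>m\<close> of the condition:
  with \<open>m = p\<^sup>s\<^sup>-\<^sup>d\<close> and \<open>n = p\<^sup>s\<close> this subgroup contains the generators of index \<open>d\<close>.
\<close>

lemma subgroup_cocycles:
  assumes "simple_graph \<Gamma>" "0 < n" "m dvd n"
  shows "subgroup {x \<in> carrier (C0 \<Gamma> n). cocycle \<Gamma> k m x} (C0 \<Gamma> n)"
proof -
  have eq: "{x \<in> carrier (C0 \<Gamma> n). cocycle \<Gamma> k m x} = cochain_mod \<Gamma> n ` {x. cocycle \<Gamma> k m x}"
  proof (intro equalityI subsetI)
    fix x assume "x \<in> {x \<in> carrier (C0 \<Gamma> n). cocycle \<Gamma> k m x}"
    then show "x \<in> cochain_mod \<Gamma> n ` {x. cocycle \<Gamma> k m x}"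
      using cochain_mod_id[OF assms(2)] by (metis (mono_tags, lifting) image_iff mem_Collect_eq)
  qed (use assms cochain_mod_in_C0 cocycle_cochain_mod_iff in blast)
  show ?thesis
    unfolding eq
  proof (rule group.subgroupI[OF group_C0])
    show "cochain_mod \<Gamma> n ` {x. cocycle \<Gamma> k m x} \<subseteq> carrier (C0 \<Gamma> n)"
      using assms(2) cochain_mod_in_C0 by blast
    have "cocycle \<Gamma> k m (\<lambda>v. 0)"
      by (simp add: cocycle_def)
    then show "cochain_mod \<Gamma> n ` {x. cocycle \<Gamma> k m x} \<noteq> {}"
      by blast
    show "inv\<^bsub>C0 \<Gamma> n\<^esub> a \<in> cochain_mod \<Gamma> n ` {x. cocycle \<Gamma> k m x}"
      if a: "a \<in> cochain_mod \<Gamma> n ` {x. cocycle \<Gamma> k m x}" for a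
    proof -
      obtain x where "cocycle \<Gamma> k m x" "a = cochain_mod \<Gamma> n x"
        using a by blast
      moreover have "cocycle \<Gamma> k m (\<lambda>v. - x v)"
        using cocycle_add_multiple[of \<Gamma> k m "\<lambda>v. 0" x "-1"] \<open>cocycle \<Gamma> k m x\<close>
        by (simp add: cocycle_def)
      ultimately show ?thesis
        using inv_C0[OF assms(2)] by auto
    qed
    show "a \<otimes>\<^bsub>C0 \<Gamma> n\<^esub> b \<in> cochain_mod \<Gamma> n ` {x. cocycle \<Gamma> k m x}"
      if ab: "a \<in> cochain_mod \<Gamma> n ` {x. cocycle \<Gamma> k m x}" "b \<in> cochain_mod \<Gamma> n ` {x. cocycle \<Gamma> k m x}" for a b
    proof -
      obtain x y where "cocycle \<Gamma> k m x" "a = cochain_mod \<Gamma> n x"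
          "cocycle \<Gamma> k m y" "b = cochain_mod \<Gamma> n y"
        using ab by blast
      then show ?thesis
        using cocycle_add_multiple[of \<Gamma> k m x y 1] by (auto simp: mult_C0)
    qed
  qed
qed

lemma d0_edge:
  assumes simple: "simple_graph \<Gamma>" and e: "{v, w} \<in> edges \<Gamma>"
  shows "d0 \<Gamma> k n x {v, w} = (x v * int (k w) + x w * int (k v)) mod int n"
proof -
  have vw: "v \<in> verts \<Gamma>" "w \<in> verts \<Gamma>" "v \<noteq> w"
    using simple_graph_edge[OF simple e] by auto
  have fin: "finite (verts \<Gamma>)"
    using simple by (simp add: simple_graph_def)
  have inner: "(\<Sum>z\<in>nbs \<Gamma> u. int (k z) * (if {u, z} = {v, w} then 1 else 0)) =
      (if u = v then int (k w) else 0) + (if u = w then int (k v) else 0)" for u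
  proof -
    have "nbs \<Gamma> u \<subseteq> verts \<Gamma>"
      using simple_graph_edge[OF simple] by (auto simp: nbs_def)
    then have "finite (nbs \<Gamma> u)"
      using fin finite_subset by blast
    have "(\<Sum>z\<in>nbs \<Gamma> u. int (k z) * (if {u, z} = {v, w} then 1 else 0)) =
        (\<Sum>z\<in>nbs \<Gamma> u. (if z = w then (if u = v then int (k w) else 0) else 0) +
           (if z = v then (if u = w then int (k v) else 0) else 0))"
      using vw(3) by (intro sum.cong) (auto simp: doubleton_eq_iff)
    also have "\<dots> = (if w \<in> nbs \<Gamma> u then if u = v then int (k w) else 0 else 0) +
        (if v \<in> nbs \<Gamma> u then if u = w then int (k v) else 0 else 0)"
      by (simp only: sum.distrib sum.delta[OF \<open>finite (nbs \<Gamma> u)\<close>])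
    also have "\<dots> = (if u = v then int (k w) else 0) + (if u = w then int (k v) else 0)"
      using e by (auto simp: nbs_def insert_commute)
    finally show ?thesis .
  qed
  have "(\<Sum>u\<in>verts \<Gamma>. x u * (\<Sum>z\<in>nbs \<Gamma> u. int (k z) * (if {u, z} = {v, w} then 1 else 0))) =
      (\<Sum>u\<in>verts \<Gamma>. (if u = v then x v * int (k w) else 0) + (if u = w then x w * int (k v) else 0))"
    unfolding inner by (intro sum.cong) (auto simp: algebra_simps)
  also have "\<dots> = x v * int (k w) + x w * int (k v)"
    using fin vw by (simp add: sum.distrib)
  finally show ?thesis
    using e by (simp add: d0_def)
qed

lemma H0_eq:
  assumes "simple_graph \<Gamma>"
  shows "H0 \<Gamma> k n = (C0 \<Gamma> n)\<lparr>carrier := {x \<in> carrier (C0 \<Gamma> n). cocycle \<Gamma> k n x}\<rparr>"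
proof -
  have "d0 \<Gamma> k n x = \<one>\<^bsub>C1 \<Gamma> n\<^esub> \<longleftrightarrow> cocycle \<Gamma> k n x" for x
  proof
    assume d: "d0 \<Gamma> k n x = \<one>\<^bsub>C1 \<Gamma> n\<^esub>"
    have "d0 \<Gamma> k n x {v, w} = 0" if "{v, w} \<in> edges \<Gamma>" for v w
      using that by (simp add: d C1_def)
    then show "cocycle \<Gamma> k n x"
      using d0_edge[OF assms] by (simp add: cocycle_def dvd_eq_mod_eq_0)
  next
    assume x: "cocycle \<Gamma> k n x"
    have "d0 \<Gamma> k n x e = 0" if e: "e \<in> edges \<Gamma>" for e
    proof -
      obtain v w where "e = {v, w}"
        using simple_graph_edgeE[OF assms e] by blast
      with e show ?thesis
        using d0_edge[OF assms] cocycleD[OF x] by (simp add: dvd_eq_mod_eq_0)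
    qed
    then show "d0 \<Gamma> k n x = \<one>\<^bsub>C1 \<Gamma> n\<^esub>"
      by (auto simp: C1_def d0_def fun_eq_iff)
  qed
  then show ?thesis
    by (simp add: H0_def kernel_def)
qed

lemma carrier_H0:
  "simple_graph \<Gamma> \<Longrightarrow> carrier (H0 \<Gamma> k n) = {x \<in> carrier (C0 \<Gamma> n). cocycle \<Gamma> k n x}"
  by (simp add: H0_eq)

lemma group_H0: "simple_graph \<Gamma> \<Longrightarrow> 0 < n \<Longrightarrow> group (H0 \<Gamma> k n)"
  by (simp add: H0_eq subgroup.subgroup_is_group subgroup_cocycles group_C0)

lemma cochain_mod_in_H0_iff:
  "simple_graph \<Gamma> \<Longrightarrow> 0 < n \<Longrightarrow> cochain_mod \<Gamma> n x \<in> carrier (H0 \<Gamma> k n) \<longleftrightarrow> cocycle \<Gamma> k n x"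
  by (simp add: carrier_H0 cochain_mod_in_C0 cocycle_cochain_mod_iff)

section \<open>Orientation classes\<close>

lemma nat_pow_in_generate: "x [^]\<^bsub>G\<^esub> (n :: nat) \<in> generate G {x}"
proof (induction n)
  case 0
  then show ?case
    by (simp add: nat_pow_def generate.one)
next
  case (Suc n)
  then show ?case
    using generate.eng[OF Suc generate.incl[of x "{x}" G]] by (simp add: nat_pow_def)
qed

text \<open>
  Evaluation at \<open>v\<close> modulo \<open>p\<close> is a homomorphism from the cocycles to \<open>\<int>/p\<close>. Rigidity identifies its
  kernel with the cocycles divisible by \<open>p\<close>, that is, with the image of \<open>i\<^sub>*\<close>; the multiples of \<open>z\<close> show
  that it is onto. The first isomorphism theorem then identifies \<open>CR\<close> with \<open>\<int>/p\<close>, the class of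
  \<open>z\<close> going to a generator.
\<close>

lemma orientation_class_by_coordinate:
  assumes simple: "simple_graph \<Delta>" and conn: "graph_connected \<Delta>" and p: "prime p" and "1 \<le> t"
    and v: "v \<in> verts \<Delta>"
    and rigid: "\<And>y u. cocycle \<Delta> k (p ^ t) y \<Longrightarrow> int p dvd y v \<Longrightarrow> u \<in> verts \<Delta> \<Longrightarrow> int p dvd y u"
    and z: "z \<in> carrier (H0 \<Delta> k (p ^ t))" "\<not> int p dvd z v"
  shows "orientation_class \<Delta> k p t z"
proof -
  define G where "G = H0 \<Delta> k (p ^ t)"
  define n where "n = p ^ t"
  define h where "h = (\<lambda>y :: 'a \<Rightarrow> int. y v mod int p)"
  define I where "I = i_image \<Delta> k p t"
  have p0: "0 < p" and n0: "0 < n"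
    using p by (auto simp: prime_gt_0_nat n_def)
  have pn: "n = p * p ^ (t - 1)"
    using \<open>1 \<le> t\<close> by (simp add: n_def power_eq_if)
  then have p_dvd_n: "int p dvd int n"
    by simp
  have G_carrier: "carrier G = {x \<in> carrier (C0 \<Delta> n). cocycle \<Delta> k n x}"
    by (simp add: G_def n_def carrier_H0 simple)
  have G_eq: "G = (C0 \<Delta> n)\<lparr>carrier := {x \<in> carrier (C0 \<Delta> n). cocycle \<Delta> k n x}\<rparr>"
    by (simp add: G_def n_def H0_eq simple)
  interpret G: group G
    unfolding G_def using group_H0[OF simple n0] by (simp add: n_def)
  have h_cochain: "h (cochain_mod \<Delta> n x) = x v mod int p" for x
    using v p_dvd_n by (simp add: h_def cochain_mod_def mod_mod_cancel)
  have G_mult: "x \<otimes>\<^bsub>G\<^esub> y = cochain_mod \<Delta> n (\<lambda>u. x u + y u)" if "x \<in> carrier G" "y \<in> carrier G" for x y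
  proof -
    have "cochain_mod \<Delta> n x = x" "cochain_mod \<Delta> n y = y"
      using that by (simp_all add: G_carrier cochain_mod_id n0)
    then show ?thesis
      using mult_C0[of \<Delta> n x y] by (simp add: G_eq)
  qed
  have "h \<in> hom G (integer_mod_group p)"
  proof (rule homI)
    show "h x \<in> carrier (integer_mod_group p)" for x
      using p0 by (simp add: h_def carrier_integer_mod_group)
    show "h (x \<otimes>\<^bsub>G\<^esub> y) = h x \<otimes>\<^bsub>integer_mod_group p\<^esub> h y" if "x \<in> carrier G" "y \<in> carrier G" for x y
      by (simp add: G_mult that h_cochain) (simp add: h_def mod_add_eq)
  qed
  then interpret h: group_hom G "integer_mod_group p" h
    by (simp add: group_hom_def group_hom_axioms_def G.is_group)
  have I_eq: "I = kernel G (integer_mod_group p) h"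
  proof (intro equalityI subsetI)
    fix y assume "y \<in> I"
    then obtain x where x: "x \<in> carrier (H0 \<Delta> k (p ^ (t - 1)))"
        and "y = i_star \<Delta> p t x"
      by (auto simp: I_def i_image_def)
    then have y: "y = cochain_mod \<Delta> n (\<lambda>u. int p * x u)"
      by (simp add: i_star_def cochain_mod_def n_def)
    have "cocycle \<Delta> k (p ^ (t - 1)) x"
      using x by (simp add: carrier_H0 simple)
    then have "cocycle \<Delta> k n (\<lambda>u. int p * x u)"
      unfolding pn cocycle_mult_iff[OF p0] .
    then have "y \<in> carrier G"
      by (simp add: y G_carrier cochain_mod_in_C0 n0 cocycle_cochain_mod_iff simple)
    then show "y \<in> kernel G (integer_mod_group p) h"
      using h_cochain[of "\<lambda>u. int p * x u"] by (simp add: kernel_def y)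
  next
    fix y assume "y \<in> kernel G (integer_mod_group p) h"
    then have y: "y \<in> carrier (C0 \<Delta> n)" "cocycle \<Delta> k n y" "int p dvd y v"
      by (auto simp: kernel_def G_carrier h_def)
    have div: "int p * (y u div int p) = y u" if "u \<in> verts \<Delta>" for u
      using rigid[of y u] y that by (simp add: n_def)
    define x where "x = cochain_mod \<Delta> (p ^ (t - 1)) (\<lambda>u. y u div int p)"
    have "cocycle \<Delta> k n (\<lambda>u. int p * (y u div int p))"
      by (rule cocycle_cong_mod[OF simple _ y(2)]) (simp add: div)
    then have "cocycle \<Delta> k (p ^ (t - 1)) (\<lambda>u. y u div int p)"
      unfolding pn cocycle_mult_iff[OF p0] .
    then have "x \<in> carrier (H0 \<Delta> k (p ^ (t - 1)))"
      unfolding x_def using simple p0 by (simp add: cochain_mod_in_H0_iff)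
    moreover have "i_star \<Delta> p t x = y"
    proof -
      have "int p * (y u div int p mod int (p ^ (t - 1))) = y u mod int n" if "u \<in> verts \<Delta>" for u
        using div[OF that] by (simp add: pn mult_mod_right)
      then have "i_star \<Delta> p t x = cochain_mod \<Delta> n y"
        by (auto simp: i_star_def x_def cochain_mod_def n_def fun_eq_iff)
      then show ?thesis
        using cochain_mod_id[OF n0 y(1)] by simp
    qed
    ultimately show "y \<in> I"
      by (auto simp: I_def i_image_def)
  qed
  have zG: "z \<in> carrier G"
    using z(1) by (simp add: G_def)
  have h_pow: "h (z [^]\<^bsub>G\<^esub> c) = int c * z v mod int p" for c :: nat
    using h.hom_nat_pow[OF zG, of c] by (simp add: h_def mod_mult_right_eq)
  have h_eq: "\<exists>c :: nat. h (z [^]\<^bsub>G\<^esub> c) = y mod int p" for y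
  proof -
    obtain c :: nat where "int p dvd y - int c * z v"
      using exists_multiple_mod_prime[OF p z(2)] by blast
    then have "h (z [^]\<^bsub>G\<^esub> c) = y mod int p"
      unfolding h_pow by (metis mod_eq_dvd_iff)
    then show ?thesis
      by blast
  qed
  have surj: "h ` carrier G = carrier (integer_mod_group p)"
  proof (intro equalityI subsetI)
    fix a assume "a \<in> carrier (integer_mod_group p)"
    then have "a = a mod int p"
      using p0 by (simp add: carrier_integer_mod_group)
    then obtain c :: nat where "h (z [^]\<^bsub>G\<^esub> c) = a"
      using h_eq[of a] by auto
    then show "a \<in> h ` carrier G"
      using zG G.nat_pow_closed by blast
  qed auto
  have CR_eq: "CR \<Delta> k p t = G Mod I"
    by (simp add: CR_def G_def I_def)
  have "oriented \<Delta> k p t"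
    unfolding oriented_def CR_eq I_eq using conn h.FactGroup_iso[OF surj] by blast
  interpret I: normal I G
    unfolding I_eq by (rule h.normal_kernel)
  have quot: "(#>\<^bsub>G\<^esub>) I \<in> hom G (G Mod I)"
    by (rule I.r_coset_hom_Mod)
  then interpret quot: group_hom G "G Mod I" "(#>\<^bsub>G\<^esub>) I"
    by (simp add: group_hom_def group_hom_axioms_def G.is_group I.factorgroup_is_group)
  have "X \<in> generate (G Mod I) {I #>\<^bsub>G\<^esub> z}" if X: "X \<in> carrier (G Mod I)" for X
  proof -
    obtain y where y: "y \<in> carrier G" "X = I #>\<^bsub>G\<^esub> y"
      using X by (auto simp: FactGroup_def RCOSETS_def)
    obtain c :: nat where c: "h (z [^]\<^bsub>G\<^esub> c) = h y"
      using h_eq[of "y v"] by (auto simp: h_def)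
    have zc: "z [^]\<^bsub>G\<^esub> c \<in> carrier G"
      using zG by (rule G.nat_pow_closed)
    have "h (y \<otimes>\<^bsub>G\<^esub> inv\<^bsub>G\<^esub> (z [^]\<^bsub>G\<^esub> c)) =
        h y \<otimes>\<^bsub>integer_mod_group p\<^esub> inv\<^bsub>integer_mod_group p\<^esub> h y"
      by (simp only: h.hom_mult[OF y(1) G.inv_closed[OF zc]] h.hom_inv[OF zc] c)
    also have "\<dots> = \<one>\<^bsub>integer_mod_group p\<^esub>"
      by (rule h.H.r_inv[OF h.hom_closed[OF y(1)]])
    finally have "y \<otimes>\<^bsub>G\<^esub> inv\<^bsub>G\<^esub> (z [^]\<^bsub>G\<^esub> c) \<in> I"
      using G.m_closed[OF y(1) G.inv_closed[OF zc]] by (simp only: I_eq kernel_def mem_Collect_eq)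
    then have "y \<in> I #>\<^bsub>G\<^esub> (z [^]\<^bsub>G\<^esub> c)"
      by (simp only: I.rcos_module[OF G.is_group zc y(1)])
    then have "X = I #>\<^bsub>G\<^esub> (z [^]\<^bsub>G\<^esub> c)"
      unfolding y(2) using G.repr_independence[OF _ zc I.subgroup_axioms] by metis
    also have "\<dots> = (I #>\<^bsub>G\<^esub> z) [^]\<^bsub>G Mod I\<^esub> c"
      by (rule quot.hom_nat_pow[OF zG])
    finally show ?thesis
      by (simp add: nat_pow_in_generate)
  qed
  moreover have "generate (G Mod I) {I #>\<^bsub>G\<^esub> z} \<subseteq> carrier (G Mod I)"
    using quot.hom_closed[OF zG] by (intro group.generate_incl I.factorgroup_is_group) simp
  ultimately have "generate (G Mod I) {I #>\<^bsub>G\<^esub> z} = carrier (G Mod I)"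
    by blast
  with \<open>oriented \<Delta> k p t\<close> z(1) show ?thesis
    by (simp add: orientation_class_def CR_eq flip: G_def I_def)
qed

section \<open>Generation of the group of cocycles\<close>

text \<open>
  The condition on \<open>\<Delta>\<close> in the definition of the generators depends on \<open>s\<close> and \<open>d\<close> only through
  \<open>t = s - d\<close>; naming it in terms of \<open>t\<close> lets the induction on \<open>s\<close> compare different moduli.
\<close>

definition admissible ::
    "'a graph \<Rightarrow> ('a \<Rightarrow> nat) \<Rightarrow> nat \<Rightarrow> (nat \<Rightarrow> 'a graph \<Rightarrow> 'a \<Rightarrow> int) \<Rightarrow> nat \<Rightarrow> 'a graph \<Rightarrow> bool" where
  "admissible \<Gamma> k p \<alpha> t \<Delta> \<longleftrightarrow> subgraph \<Delta> \<Gamma> \<and> graph_connected \<Delta> \<and>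
     enat (m_val p k \<Delta> + t) \<le> r_val p \<Gamma> k \<Delta> \<and>
     component \<Delta> (Red p (r_val p \<Gamma> k \<Delta>) \<Gamma> k) \<and>
     orienting_sign \<Delta> k p t (\<alpha> t \<Delta>)"

lemma D_gens_eq:
  "D_gens \<Gamma> k p \<alpha> s d =
     {cochain_mod \<Gamma> (p ^ s) (Div (\<alpha> (s - d) \<Delta>) k \<Delta>) | \<Delta>. admissible \<Gamma> k p \<alpha> (s - d) \<Delta>}"
  by (simp add: D_gens_def admissible_def)

text \<open>
  Inside \<open>\<Delta>\<close> this is part of being an orientation class. Edges in the boundary have valuation at least
  \<open>m(\<Delta>) + t\<close>, and at most \<open>m(\<Delta>)\<close> of it is lost to the division by \<open>g\<close>.
\<close>

lemma admissible_Div_cocycle: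
  assumes scheme: "negative_color_scheme \<Gamma> k" and p: "prime p" and adm: "admissible \<Gamma> k p \<alpha> t \<Delta>"
  shows "cocycle \<Gamma> k (p ^ t) (Div (\<alpha> t \<Delta>) k \<Delta>)"
proof -
  have sub: "subgraph \<Delta> \<Gamma>" and ne: "verts \<Delta> \<noteq> {}"
      and r: "enat (m_val p k \<Delta> + t) \<le> r_val p \<Gamma> k \<Delta>"
    using adm by (auto simp: admissible_def graph_connected_def)
  have simple: "simple_graph \<Delta>" and scheme': "negative_color_scheme \<Delta> k"
    using sub scheme negative_color_scheme_subgraph by (auto simp: subgraph_def)
  have "cocycle \<Delta> k (p ^ t) (Div (\<alpha> t \<Delta>) k \<Delta>)"
    using adm cochain_mod_in_H0_iff[OF simple, of "p ^ t"] p
    by (simp add: admissible_def orienting_sign_def orientation_class_def prime_gt_0_nat)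
  moreover have "int p ^ t dvd Div (\<alpha> t \<Delta>) k \<Delta> v * int (k w) + Div (\<alpha> t \<Delta>) k \<Delta> w * int (k v)"
    if e: "{v, w} \<in> edges \<Gamma>" "{v, w} \<notin> edges \<Delta>" for v w
  proof (cases "{v, w} \<inter> verts \<Delta> = {}")
    case True
    then show ?thesis
      by (simp add: Div_def)
  next
    case False
    then have "{v, w} \<in> edge_boundary \<Gamma> \<Delta>"
      using e by (simp add: edge_boundary_def)
    then have "r_val p \<Gamma> k \<Delta> \<le> enat (edge_val p k {v, w})"
      unfolding r_val_def by (rule INF_lower)
    with r have "enat (m_val p k \<Delta> + t) \<le> enat (edge_val p k {v, w})"
      by (rule order_trans)
    then have "m_val p k \<Delta> + t \<le> multiplicity p (k v) + multiplicity p (k w)"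
      using edge_val_eq[OF scheme p e(1)] by simp
    then have "int p ^ (m_val p k \<Delta> + t) dvd int p ^ (multiplicity p (k v) + multiplicity p (k w))"
      by (rule le_imp_power_dvd)
    also have "\<dots> dvd int (k v) * int (k w)"
      unfolding power_add by (intro mult_dvd_mono prime_power_dvd_weight) simp_all
    finally show ?thesis
      by (intro Div_edge_dvd[OF scheme' p ne]) simp
  qed
  ultimately show ?thesis
    unfolding cocycle_def by (metis of_nat_power)
qed

text \<open>
  Every vertex at which a cocycle is a unit lies in a component that contributes a generator with
  \<open>d = 0\<close>. The last conclusion is the rigidity that makes one multiple of \<open>Div\<close> suffice to clear \<open>x\<close>
  modulo \<open>p\<close> on the whole component.
\<close>

lemma exists_admissible:
  assumes scheme: "negative_color_scheme \<Gamma> k" and p: "prime p" and \<alpha>: "sign_choice \<Gamma> k p \<alpha>"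
    and "1 \<le> t" and x: "cocycle \<Gamma> k (p ^ t) x" "\<not> int p dvd x v" and v: "v \<in> verts \<Gamma>"
  obtains \<Delta> where "admissible \<Gamma> k p \<alpha> t \<Delta>" "v \<in> verts \<Delta>"
    "\<not> int p dvd Div (\<alpha> t \<Delta>) k \<Delta> v"
    "\<And>y u. cocycle \<Gamma> k (p ^ t) y \<Longrightarrow> int p dvd y v \<Longrightarrow> u \<in> verts \<Delta> \<Longrightarrow> int p dvd y u"
proof -
  define m where "m = multiplicity p (k v)"
  have "simple_graph \<Gamma>"
    using scheme by (simp add: negative_color_scheme_def)
  from exists_boundary_bounded_component[OF this v, of p k "m + t"]
  obtain \<Delta> where sub: "subgraph \<Delta> \<Gamma>" and conn: "graph_connected \<Delta>" and v\<Delta>: "v \<in> verts \<Delta>"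
    and val: "\<And>e. e \<in> edges \<Delta> \<Longrightarrow> edge_val p k e < m + t"
    and r: "enat (m + t) \<le> r_val p \<Gamma> k \<Delta>"
    and comp: "component \<Delta> (Red p (r_val p \<Gamma> k \<Delta>) \<Gamma> k)"
    by blast
  have simple: "simple_graph \<Delta>" and scheme': "negative_color_scheme \<Delta> k"
    using sub scheme negative_color_scheme_subgraph by (auto simp: subgraph_def)
  have x': "cocycle \<Delta> k (p ^ t) x"
    using x(1) sub by (rule cocycle_subgraph)
  note local = scheme' p \<open>1 \<le> t\<close> conn v\<Delta> val[unfolded m_def] x' x(2)
  have min: "m \<le> multiplicity p (k u)" if "u \<in> verts \<Delta>" for u
    unfolding m_def by (rule weight_minimal_at_unit[OF local that])
  have m: "m_val p k \<Delta> = m"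
    unfolding m_def by (intro m_val_eqI[OF simple v\<Delta>]) (simp add: min flip: m_def)
  have rigid: "int p dvd y u"
    if "cocycle \<Delta> k (p ^ t) y" "int p dvd y v" "u \<in> verts \<Delta>" for y u
    by (rule cocycle_rigidity[OF scheme' p conn v\<Delta> min m_def[symmetric] val that])
  obtain \<beta> where \<beta>: "sign_function \<Delta> \<beta>" "cocycle \<Delta> k (p ^ t) (Div \<beta> k \<Delta>)"
    using exists_sign_cocycle[OF local] by blast
  have unit: "\<not> int p dvd Div \<gamma> k \<Delta> v" if "sign_function \<Delta> \<gamma>" for \<gamma>
    by (rule Div_unit[OF scheme' p v\<Delta> that]) (simp add: m m_def)
  have "orientation_class \<Delta> k p t (cochain_mod \<Delta> (p ^ t) (Div \<beta> k \<Delta>))"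
  proof (rule orientation_class_by_coordinate[OF simple conn p \<open>1 \<le> t\<close> v\<Delta>])
    show "int p dvd y u" if "cocycle \<Delta> k (p ^ t) y" "int p dvd y v" "u \<in> verts \<Delta>" for y u
      using that by (rule rigid)
    show "cochain_mod \<Delta> (p ^ t) (Div \<beta> k \<Delta>) \<in> carrier (H0 \<Delta> k (p ^ t))"
      using \<beta>(2) p by (simp add: cochain_mod_in_H0_iff simple prime_gt_0_nat)
    have "int p dvd int (p ^ t)"
      using \<open>1 \<le> t\<close> by (simp add: dvd_power)
    then show "\<not> int p dvd cochain_mod \<Delta> (p ^ t) (Div \<beta> k \<Delta>) v"
      using unit[OF \<beta>(1)] v\<Delta> by (simp add: cochain_mod_def dvd_mod_iff)
  qed
  then have "orienting_sign \<Delta> k p t \<beta>"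
    using \<beta>(1) by (simp add: orienting_sign_def)
  then have \<alpha>t: "orienting_sign \<Delta> k p t (\<alpha> t \<Delta>)"
    using \<alpha> sub conn \<open>1 \<le> t\<close> unfolding sign_choice_def by blast
  then have "\<not> int p dvd Div (\<alpha> t \<Delta>) k \<Delta> v"
    by (intro unit) (simp add: orienting_sign_def)
  moreover have "admissible \<Gamma> k p \<alpha> t \<Delta>"
    using sub conn r comp \<alpha>t by (simp add: admissible_def m)
  ultimately show thesis
    using that v\<Delta> rigid cocycle_subgraph[OF _ sub] by blast
qed

text \<open>
  The generation statement, freed of the group structure: a property of integral cochains that holds
  for the multiples of \<open>p\<^sup>s\<close> and survives the addition of multiples of generators holds for all
  cocycles modulo \<open>p\<^sup>s\<close>. The outer induction is on \<open>s\<close>; the inner one is on the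
  number of vertices at which the cocycle is not divisible by \<open>p\<close>.
\<close>

lemma cocycle_induct [consumes 4, case_names zero add]:
  assumes scheme: "negative_color_scheme \<Gamma> k" and p: "prime p" and \<alpha>: "sign_choice \<Gamma> k p \<alpha>"
    and "cocycle \<Gamma> k (p ^ s) x"
    and "\<And>y. (\<And>v. v \<in> verts \<Gamma> \<Longrightarrow> int p ^ s dvd y v) \<Longrightarrow> P y"
    and "\<And>y c d \<Delta>. P y \<Longrightarrow> d < s \<Longrightarrow> admissible \<Gamma> k p \<alpha> (s - d) \<Delta> \<Longrightarrow>
       P (\<lambda>v. y v + int p ^ d * (int c * Div (\<alpha> (s - d) \<Delta>) k \<Delta> v))"
  shows "P x"
  using assms(4-)
proof (induction s arbitrary: x P)
  case 0
  then show ?case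
    by simp
next
  case (Suc s)
  note zero = Suc.prems(2) and add = Suc.prems(3)
  have fin: "finite (verts \<Gamma>)" and simple: "simple_graph \<Gamma>"
    using scheme by (auto simp: negative_color_scheme_def simple_graph_def)
  have "P x" if "cocycle \<Gamma> k (p ^ Suc s) x" for x
    using that
  proof (induction "card {v \<in> verts \<Gamma>. \<not> int p dvd x v}" arbitrary: x rule: less_induct)
    case less
    show "P x"
    proof (cases "\<exists>v\<in>verts \<Gamma>. \<not> int p dvd x v")
      case True
      then obtain v where v: "v \<in> verts \<Gamma>" "\<not> int p dvd x v"
        by blast
      obtain \<Delta> where \<Delta>: "admissible \<Gamma> k p \<alpha> (Suc s) \<Delta>" "v \<in> verts \<Delta>"
          "\<not> int p dvd Div (\<alpha> (Suc s) \<Delta>) k \<Delta> v"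
        and rigid: "\<And>y u. cocycle \<Gamma> k (p ^ Suc s) y \<Longrightarrow> int p dvd y v \<Longrightarrow> u \<in> verts \<Delta> \<Longrightarrow> int p dvd y u"
        using exists_admissible[OF scheme p \<alpha> _ less.prems v(2,1)] by auto
      \<comment> \<open>At a unit of \<open>x\<close>, some multiple of \<open>Div\<close> cancels \<open>x\<close> modulo \<open>p\<close>, and by rigidity on all of \<open>\<Delta>\<close>.\<close>
      define z where "z = Div (\<alpha> (Suc s) \<Delta>) k \<Delta>"
      obtain c :: nat where c: "int p dvd x v - int c * z v"
        using exists_multiple_mod_prime[OF p \<Delta>(3)] by (auto simp: z_def)
      define y where "y = (\<lambda>u. x u - int c * z u)"
      have y: "cocycle \<Gamma> k (p ^ Suc s) y"
        using cocycle_add_multiple[OF less.prems admissible_Div_cocycle[OF scheme p \<Delta>(1)], of "- int c"]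
        by (simp add: y_def z_def)
      have "int p dvd y u" if "u \<in> verts \<Delta>" for u
        using rigid[OF y _ that] c by (simp add: y_def)
      moreover have "y u = x u" if "u \<notin> verts \<Delta>" for u
        using that by (simp add: y_def z_def Div_def)
      ultimately have "{u \<in> verts \<Gamma>. \<not> int p dvd y u} \<subset> {u \<in> verts \<Gamma>. \<not> int p dvd x u}"
        using v \<Delta>(2) by (auto, metis+)
      then have "card {u \<in> verts \<Gamma>. \<not> int p dvd y u} < card {u \<in> verts \<Gamma>. \<not> int p dvd x u}"
        using fin by (intro psubset_card_mono) auto
      then have "P y"
        using y by (rule less.hyps)
      then have "P (\<lambda>u. y u + int p ^ 0 * (int c * z u))"
        using add[of y 0 \<Delta> c] \<Delta>(1) by (simp add: z_def)
      then show ?thesis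
        by (simp add: y_def)
    next
      case False
      define y where "y = (\<lambda>v. x v div int p)"
      have xy: "x v = int p * y v" if "v \<in> verts \<Gamma>" for v
        using False that by (simp add: y_def)
      have "cocycle \<Gamma> k (p * p ^ s) (\<lambda>v. int p * y v)"
        using cocycle_cong_mod[OF simple _ less.prems, of "\<lambda>v. int p * y v"] xy by simp
      then have "cocycle \<Gamma> k (p ^ s) y"
        using cocycle_mult_iff p prime_gt_0_nat by blast
      \<comment> \<open>The values of \<open>x\<close> outside the graph are arbitrary and need not be divisible by \<open>p\<close>, hence
        the induction hypothesis is applied to a property of all cochains that agree with \<open>p y\<close> on
        the vertices.\<close>
      then have "\<forall>x. (\<forall>v\<in>verts \<Gamma>. x v = int p * y v) \<longrightarrow> P x"
      proof (rule Suc.IH)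
        fix y assume y: "\<And>v. v \<in> verts \<Gamma> \<Longrightarrow> int p ^ s dvd y v"
        show "\<forall>x. (\<forall>v\<in>verts \<Gamma>. x v = int p * y v) \<longrightarrow> P x"
          using y by (auto intro!: zero)
      next
        fix y c d \<Delta>
        assume y: "\<forall>x. (\<forall>v\<in>verts \<Gamma>. x v = int p * y v) \<longrightarrow> P x" and d: "d < s"
          and \<Delta>: "admissible \<Gamma> k p \<alpha> (s - d) \<Delta>"
        show "\<forall>x. (\<forall>v\<in>verts \<Gamma>. x v =
            int p * (y v + int p ^ d * (int c * Div (\<alpha> (s - d) \<Delta>) k \<Delta> v))) \<longrightarrow> P x"
        proof (intro allI impI)
          fix x assume x: "\<forall>v\<in>verts \<Gamma>. x v =
            int p * (y v + int p ^ d * (int c * Div (\<alpha> (s - d) \<Delta>) k \<Delta> v))"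
          define x' where "x' v = x v - int p ^ Suc d * (int c * Div (\<alpha> (s - d) \<Delta>) k \<Delta> v)" for v
          have "P x'"
            using y x by (simp add: x'_def algebra_simps)
          then have "P (\<lambda>v. x' v + int p ^ Suc d * (int c * Div (\<alpha> (s - d) \<Delta>) k \<Delta> v))"
            using add[of x' "Suc d" \<Delta> c] d \<Delta> by simp
          then show "P x"
            by (simp add: x'_def)
        qed
      qed
      then show ?thesis
        using xy by blast
    qed
  qed
  then show ?case
    using Suc.prems(1) .
qed

text \<open>
  Multiplication by \<open>p\<^sup>d\<close> turns a cocycle modulo \<open>p\<^sup>s\<^sup>-\<^sup>d\<close> into one modulo \<open>p\<^sup>s\<close>.
\<close>

lemma subgroup_pD:
  assumes scheme: "negative_color_scheme \<Gamma> k" and p: "prime p" and "d < s"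
  shows "subgroup (pD \<Gamma> k p \<alpha> s d) (H0 \<Gamma> k (p ^ s))"
proof -
  let ?C = "C0 \<Gamma> (p ^ s)"
  have simple: "simple_graph \<Gamma>"
    using scheme by (simp add: negative_color_scheme_def)
  have n0: "0 < p ^ s"
    using p by (simp add: prime_gt_0_nat)
  have "p ^ (s - d) dvd p ^ s"
    by (simp add: le_imp_power_dvd)
  then have sub: "subgroup {x \<in> carrier ?C. cocycle \<Gamma> k (p ^ (s - d)) x} ?C"
    and dvd: "p ^ (s - d) dvd p ^ s"
    using subgroup_cocycles[OF simple n0] by auto
  have gens: "D_gens \<Gamma> k p \<alpha> s d \<subseteq> {x \<in> carrier ?C. cocycle \<Gamma> k (p ^ (s - d)) x}"
    using admissible_Div_cocycle[OF scheme p] cochain_mod_in_C0[OF n0]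
      cocycle_cochain_mod_iff[OF simple dvd] by (auto simp: D_gens_eq)
  then have D_sub: "D \<Gamma> k p \<alpha> s d \<subseteq> {x \<in> carrier ?C. cocycle \<Gamma> k (p ^ (s - d)) x}"
    unfolding D_def using group.generate_subgroup_incl[OF group_C0 _ sub] by blast
  have "subgroup (D \<Gamma> k p \<alpha> s d) ?C"
    unfolding D_def using gens by (intro group.generate_is_subgroup group_C0) auto
  moreover have "(\<lambda>x. x [^]\<^bsub>?C\<^esub> (p ^ d)) \<in> hom ?C ?C"
    using comm_group_C0[of \<Gamma> "p ^ s"] group_C0[of \<Gamma> "p ^ s"]
    by (intro homI) (auto intro: monoid.nat_pow_closed group.is_monoid
        simp: comm_monoid.nat_pow_distrib comm_group_def)
  then have "group_hom ?C ?C (\<lambda>x. x [^]\<^bsub>?C\<^esub> (p ^ d))"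
    by (simp add: group_hom_def group_hom_axioms_def group_C0)
  ultimately have pD: "subgroup (pD \<Gamma> k p \<alpha> s d) ?C"
    unfolding pD_def by (rule group_hom.subgroup_img_is_subgroup[rotated])
  have "cocycle \<Gamma> k (p ^ s) (x [^]\<^bsub>?C\<^esub> (p ^ d))"
    if "x \<in> carrier ?C" "cocycle \<Gamma> k (p ^ (s - d)) x" for x
  proof -
    have "cocycle \<Gamma> k (p ^ d * p ^ (s - d)) (\<lambda>v. int (p ^ d) * x v)"
      using that(2) p by (subst cocycle_mult_iff) (simp_all add: prime_gt_0_nat)
    then have "cocycle \<Gamma> k (p ^ s) (\<lambda>v. int (p ^ d) * x v)"
      using \<open>d < s\<close> by (simp flip: power_add)
    then show ?thesis
      using pow_C0[of \<Gamma> "p ^ s" x "p ^ d"] cochain_mod_id[OF n0 that(1)]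
        cocycle_cochain_mod_iff[OF simple dvd_refl] by simp
  qed
  then have "pD \<Gamma> k p \<alpha> s d \<subseteq> {x \<in> carrier ?C. cocycle \<Gamma> k (p ^ s) x}"
    using D_sub subgroup.subset[OF pD] by (auto simp: pD_def)
  then show ?thesis
    unfolding H0_eq[OF simple]
    using group.subgroup_incl[OF group_C0 pD subgroup_cocycles[OF simple n0 dvd_refl]] by simp
qed

theorem theorem26:
  fixes \<Gamma> :: "'a graph" and k :: "'a \<Rightarrow> nat" and p s :: nat
    and \<alpha> :: "nat \<Rightarrow> 'a graph \<Rightarrow> 'a \<Rightarrow> int"
  assumes "negative_color_scheme \<Gamma> k"
    and "prime p"
    and "s \<ge> 1"
    and "sign_choice \<Gamma> k p \<alpha>"
  shows "(\<forall>d<s. subgroup (pD \<Gamma> k p \<alpha> s d) (H0 \<Gamma> k (p ^ s))) \<and>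
         generate (H0 \<Gamma> k (p ^ s)) (\<Union>d<s. pD \<Gamma> k p \<alpha> s d) = carrier (H0 \<Gamma> k (p ^ s))"
proof (intro conjI allI impI equalityI subsetI)
  show sub: "subgroup (pD \<Gamma> k p \<alpha> s d) (H0 \<Gamma> k (p ^ s))" if "d < s" for d
    using assms(1,2) that by (rule subgroup_pD)
  let ?C = "C0 \<Gamma> (p ^ s)" and ?H = "H0 \<Gamma> k (p ^ s)" and ?U = "\<Union>d<s. pD \<Gamma> k p \<alpha> s d"
  have simple: "simple_graph \<Gamma>"
    using assms(1) by (simp add: negative_color_scheme_def)
  have n0: "0 < p ^ s"
    using assms(2) by (simp add: prime_gt_0_nat)
  have H_mult: "x \<otimes>\<^bsub>?H\<^esub> y = x \<otimes>\<^bsub>?C\<^esub> y" and H_one: "\<one>\<^bsub>?H\<^esub> = \<one>\<^bsub>?C\<^esub>" for x y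
    by (simp_all add: H0_eq[OF simple])
  have "?U \<subseteq> carrier ?H"
    using sub subgroup.subset by blast
  then show "x \<in> carrier ?H" if "x \<in> generate ?H ?U" for x
    using group.generate_in_carrier[OF group_H0[OF simple n0]] that by blast
  fix x assume x: "x \<in> carrier ?H"
  then have "cocycle \<Gamma> k (p ^ s) x"
    by (simp add: carrier_H0 simple)
  from assms(1,2,4) this have "cochain_mod \<Gamma> (p ^ s) x \<in> generate ?H ?U"
  proof (induction rule: cocycle_induct)
    case (zero y)
    have "cochain_mod \<Gamma> (p ^ s) y = \<one>\<^bsub>?H\<^esub>"
      unfolding H_one one_C0 using zero by (intro cochain_mod_cong) simp
    then show ?case
      by (simp add: generate.one)
  next
    case (add y c d \<Delta>)
    let ?z = "Div (\<alpha> (s - d) \<Delta>) k \<Delta>"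
    have "cochain_mod \<Gamma> (p ^ s) ?z \<in> D_gens \<Gamma> k p \<alpha> s d"
      using add by (auto simp: D_gens_eq)
    then have "generate ?C {cochain_mod \<Gamma> (p ^ s) ?z} \<subseteq> D \<Gamma> k p \<alpha> s d"
      unfolding D_def by (intro group.mono_generate[OF group_C0]) simp
    then have "cochain_mod \<Gamma> (p ^ s) ?z [^]\<^bsub>?C\<^esub> c \<in> D \<Gamma> k p \<alpha> s d"
      using nat_pow_in_generate by (rule subsetD)
    then have "(cochain_mod \<Gamma> (p ^ s) ?z [^]\<^bsub>?C\<^esub> c) [^]\<^bsub>?C\<^esub> (p ^ d) \<in> ?U"
      using add(2) unfolding pD_def by blast
    then have "cochain_mod \<Gamma> (p ^ s) (\<lambda>v. int p ^ d * (int c * ?z v)) \<in> ?U"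
      by (simp add: pow_C0)
    from generate.eng[OF add(1) generate.incl[OF this]] show ?case
      by (simp add: H_mult mult_C0)
  qed
  moreover have "x \<in> carrier ?C"
    using x by (simp add: carrier_H0 simple)
  ultimately show "x \<in> generate ?H ?U"
    by (simp only: cochain_mod_id[OF n0])
qed

end
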